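(* Let $f:\mathbb{R}^d\to\mathbb{R}$ be Lipschitz continuous with constant $L_0>0$, i.e. $|f(z_1)-f(z_2)|\le L_0\|z_1-z_2\|$ for all $z_1,z_2\in\mathbb{R}^d$ ($f$ need not be differentiable). Let $\mu>0$, let $L_1(f_\mu)>0$ be the Lipschitz constant of the gradient of $f_\mu$, i.e. $\|\nabla f_\mu(z_1)-\nabla f_\mu(z_2)\|_*\le L_1(f_\mu)\|z_1-z_2\|$ for all $z_1,z_2$, and let $\sigma\ge 0$ satisfy $E_u[\|G_\mu(z;u)-F_\mu(z)\|_*^2]\le\sigma^2$ for all $z\in\mathbb{R}^d$. Suppose that for some $\rho\in[0,\frac{1}{4L_1(f_\mu)\kappa^2})$ there is $z^*\in\mathbb{R}^d$ such that $$\langle F_\mu(z),z-z^*\rangle+\frac{\rho}{2}\|F_\mu(z)\|_*^2\ge0\quad\text{for all }z\in\mathbb{R}^d.$$ Let $\{z_k\}_{k\ge0}$, $\{\hat z_k\}_{k\ge0}$ be generated by the zeroth-order extragradient algorithm (ZO-EG, unconstrained) with constant step sizes $h_1,h_2>0$ satisfying $h_1\le\frac{1}{L_1(f_\mu)\overline{\lambda}\kappa}$ and $h_2\in\left(\sqrt{\frac{\rho}{L_1(f_\mu)\overline{\lambda}\underline{\lambda}\kappa}},\frac{h_1}{2}\right]$. Then for every number of iterations $N\ge0$, $$\frac{1}{N+1}\sum_{k=0}^{N}E_{\mathcal{U}_k}[|F_\mu(\hat z_k)|^2]\le\frac{2L_1(f_\mu)\overline{\lambda}\underline{\lambda}\kappa|z_0-z^*|^2}{(L_1(f_\mu)\overline{\lambda}\underline{\lambda}\kappa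 h_2^2-\rho)(N+1)}+\frac{3\underline{\lambda}}{L_1(f_\mu)\kappa(L_1(f_\mu)\overline{\lambda}\underline{\lambda}\kappa h_2^2-\rho)}\sigma^2.$$
   Context: $n,m\in\mathbb{N}$, $d=n+m$, points $z=(x,y)\in\mathbb{R}^n\times\mathbb{R}^m=\mathbb{R}^d$. $B_1\in\mathbb{R}^{n\times n}$, $B_2\in\mathbb{R}^{m\times m}$ are symmetric positive definite, $B$ is the block-diagonal matrix with blocks $B_1,B_2$; $\underline{\lambda}$, $\overline{\lambda}$ are its smallest and largest eigenvalues and $\kappa=\overline{\lambda}/\underline{\lambda}$. $\langle\cdot,\cdot\rangle$ is the Euclidean inner product, $|z|=\langle z,z\rangle^{1/2}$ (absolute value for scalars), $\|z\|=\langle z,Bz\rangle^{1/2}$, $\|z\|_*=\langle z,B^{-1}z\rangle^{1/2}$. For $\mu>0$ the Gaussian smoothing of $f$ is $f_\mu(z)=E_u[f(z+\mu u)]$ with $u\sim\mathcal{N}(0,B^{-1})$ (it is continuously differentiable, and for Lipschitz $f$ its gradient is Lipschitz), and $F_\mu(z)=(\nabla_x f_\mu(z),-\nabla_y f_\mu(z))$. For $u=(u_1,u_2)\in\mathbb{R}^n\times\mathbb{R}^m$ the random oracle is $G_\mu(z;u)=\frac{f(z+\mu u)-f(z)}{\mu}\,(B_1u_1,-B_2u_2)$. ZO-EG (unconstrained): given $z_0\in\mathbb{R}^d$, for $k=0,1,\dots,N$: sample $\hat u_k\sim\mathcal{N}(0,B^{-1})$ and set $\hat z_k=z_k-h_1G_\mu(z_k;\hat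 u_k)$; sample $u_k\sim\mathcal{N}(0,B^{-1})$ and set $z_{k+1}=z_k-h_2G_\mu(\hat z_k;u_k)$. All sampled vectors are independent. $\mathcal{U}_k=[(u_0,\hat u_0),\dots,(u_k,\hat u_k)]$ and $E_{\mathcal{U}_k}$ is expectation over $\mathcal{U}_k$. *)

theory Defs
  imports "HOL-Probability.Probability"
begin

text \<open>
  The space \<open>\<real>\<^sup>d = \<real>\<^sup>n \<times> \<real>\<^sup>m\<close> is the type \<open>(real^'n) \<times> (real^'m)\<close>, whose library inner product
  and norm are the Euclidean ones. A block-diagonal matrix is given by its two diagonal blocks
  and acts on this type as the following linear map.
\<close>

definition block_diag ::
  "real^'n^'n \<Rightarrow> real^'m^'m \<Rightarrow> (real^'n) \<times> (real^'m) \<Rightarrow> (real^'n) \<times> (real^'m)"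
  where "block_diag B1 B2 z = (B1 *v fst z, B2 *v snd z)"

definition sym_pos_def :: "real^'n^'n \<Rightarrow> bool"
  where "sym_pos_def A \<longleftrightarrow> transpose A = A \<and> (\<forall>v. v \<noteq> 0 \<longrightarrow> v \<bullet> (A *v v) > 0)"

definition eigenvalues :: "('a::real_vector \<Rightarrow> 'a) \<Rightarrow> real set"
  where "eigenvalues A = {l. \<exists>v. v \<noteq> 0 \<and> A v = l *\<^sub>R v}"

text \<open>
  For \<open>B = block_diag B1 B2\<close>, the primal norm of \<open>z\<close> is \<open>wnorm B z\<close> and the dual norm
  is \<open>wnorm (inv B) z\<close>.
\<close>

definition wnorm :: "('a::real_inner \<Rightarrow> 'a) \<Rightarrow> 'a \<Rightarrow> real"
  where "wnorm A z = sqrt (z \<bullet> A z)"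

text \<open>
  The centred normal distribution whose covariance is the inverse of the block-diagonal matrix
  with blocks \<open>B1\<close>, \<open>B2\<close>; the determinant of that matrix is \<open>det B1 * det B2\<close>.
\<close>

definition gaussian ::
  "real^'n^'n \<Rightarrow> real^'m^'m \<Rightarrow> ((real^'n) \<times> (real^'m)) measure"
  where "gaussian B1 B2 = density lborel
    (\<lambda>u. ennreal (sqrt (det B1 * det B2 / (2 * pi) ^ (CARD('n) + CARD('m)))
                 * exp (- (u \<bullet> block_diag B1 B2 u) / 2)))"

definition smoothing ::
  "real^'n^'n \<Rightarrow> real^'m^'m \<Rightarrow> real \<Rightarrow> ((real^'n) \<times> (real^'m) \<Rightarrow> real)
    \<Rightarrow> (real^'n) \<times> (real^'m) \<Rightarrow> real"
  where "smoothing B1 B2 \<mu> f z = (\<integral>u. f (z + \<mu> *\<^sub>R u) \<partial>gaussian B1 B2)"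

definition grad :: "('a::real_inner \<Rightarrow> real) \<Rightarrow> 'a \<Rightarrow> 'a"
  where "grad f z = (THE D. GDERIV f z :> D)"

definition saddle_op ::
  "((real^'n) \<times> (real^'m) \<Rightarrow> real) \<Rightarrow> (real^'n) \<times> (real^'m) \<Rightarrow> (real^'n) \<times> (real^'m)"
  where "saddle_op g z =
    (grad (\<lambda>x. g (x, snd z)) (fst z), - grad (\<lambda>y. g (fst z, y)) (snd z))"

definition zo_oracle ::
  "real^'n^'n \<Rightarrow> real^'m^'m \<Rightarrow> real \<Rightarrow> ((real^'n) \<times> (real^'m) \<Rightarrow> real)
    \<Rightarrow> (real^'n) \<times> (real^'m) \<Rightarrow> (real^'n) \<times> (real^'m) \<Rightarrow> (real^'n) \<times> (real^'m)"
  where "zo_oracle B1 B2 \<mu> f z u =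
    ((f (z + \<mu> *\<^sub>R u) - f z) / \<mu>) *\<^sub>R (B1 *v fst u, - (B2 *v snd u))"

end

theory Submission
  imports Defs
begin

text \<open>
  Differentiating the Gaussian density instead of \<open>f\<close> shows that the smoothing is differentiable and
  that the oracle is an unbiased estimator of the saddle operator \<open>F\<close>. In the Euclidean norm \<open>F\<close> is
  \<open>L1 * lmax\<close>-Lipschitz and the noise has variance at most \<open>lmax * \<sigma>\<^sup>2\<close>.

  Write \<open>Gh\<close> for the oracle value at \<open>z\<close>, \<open>zh = z - h1 Gh\<close> and \<open>\<xi> = Gh - F z\<close>. Expanding
  \<open>norm (z' - zs)\<^sup>2\<close> and using the weak Minty inequality at \<open>zh\<close> leaves the term \<open>- 2 h1 h2 (F zh \<bullet> Gh)\<close>.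
  By polarization it is controlled by \<open>norm (F zh - F z)\<^sup>2 \<le> norm Gh\<^sup>2\<close> and \<open>- (F zh - F z) \<bullet> \<xi>\<close>.
  In the latter \<open>F z\<close> may be replaced, up to a term of mean zero, by \<open>F\<close> at the noiseless point
  \<open>z - h1 F z\<close>, whose distance to \<open>zh\<close> is \<open>h1 * norm \<xi>\<close>. Telescoping the resulting
  one-step descent inequality gives the rate.
\<close>

subsection \<open>Extremal eigenvalues of self-adjoint maps\<close>

locale self_adjoint =
  fixes A :: "'a::euclidean_space \<Rightarrow> 'a"
  assumes linear: "linear A"
    and sym: "A x \<bullet> y = x \<bullet> A y"
begin

text \<open>Eigenvectors for distinct eigenvalues are orthogonal, hence independent, so choosing one
  per eigenvalue embeds the spectrum into a finite set. Only finiteness gives \<open>Max\<close> and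
  \<open>Min\<close> of the spectrum their meaning.\<close>

lemma eigenvalues_finite: "finite (eigenvalues A)"
proof -
  have "\<forall>l\<in>eigenvalues A. \<exists>v. v \<noteq> 0 \<and> A v = l *\<^sub>R v"
    by (auto simp: eigenvalues_def)
  then obtain e where e: "\<And>l. l \<in> eigenvalues A \<Longrightarrow> e l \<noteq> 0 \<and> A (e l) = l *\<^sub>R e l"
    by metis
  have orth: "e l \<bullet> e k = 0" if "l \<in> eigenvalues A" "k \<in> eigenvalues A" "l \<noteq> k" for l k
    using sym[of "e l" "e k"] e[OF that(1)] e[OF that(2)] that(3) by simp
  have inj: "inj_on e (eigenvalues A)"
    by (rule inj_onI) (metis e inner_eq_zero_iff orth)
  have "pairwise orthogonal (e ` eigenvalues A)"
    by (auto simp: pairwise_def orthogonal_def intro!: orth)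
  moreover have "0 \<notin> e ` eigenvalues A"
    using e by fastforce
  ultimately have "finite (e ` eigenvalues A)"
    by (meson independent_bound pairwise_orthogonal_independent)
  then show ?thesis
    using inj finite_imageD by blast
qed

text \<open>A zero of a nonnegative form is a minimum. If \<open>A v\<close> were nonzero, moving
  \<open>v\<close> slightly against \<open>A v\<close> would make the form negative.\<close>

lemma nonneg_form_kernel:
  assumes "\<And>w. 0 \<le> w \<bullet> A w" and "v \<bullet> A v = 0"
  shows "A v = 0"
proof (rule ccontr)
  assume "A v \<noteq> 0"
  define a where "a = A v \<bullet> A v"
  define b where "b = A v \<bullet> A (A v)"
  have "a > 0" using \<open>A v \<noteq> 0\<close> by (simp add: a_def)
  have "b \<ge> 0" using assms(1) by (simp add: b_def)
  \<comment> \<open>The form at the perturbed vector is \<open>2 * t * a + t\<^sup>2 * b\<close>.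
    Its minimizer would be \<open>- a / b\<close>; the added 1 keeps the denominator positive when
    \<open>b\<close> is 0 and still gives a negative value.\<close>
  define t where "t = - a / (b + 1)"
  have "0 \<le> (v + t *\<^sub>R A v) \<bullet> A (v + t *\<^sub>R A v)" by (rule assms(1))
  also have "\<dots> = 2 * t * a + t\<^sup>2 * b"
    using assms(2) sym[of v "A v"]
    by (simp add: linear_add[OF linear] linear_scale[OF linear] inner_add_left inner_add_right
        a_def b_def power2_eq_square algebra_simps)
  also have "\<dots> = a\<^sup>2 * (b - 2 * (b + 1)) / (b + 1)\<^sup>2"
  proof -
    have "t * (b + 1) = - a" using \<open>b \<ge> 0\<close> by (simp add: t_def)
    then have "(2 * t * a + t\<^sup>2 * b) * (b + 1)\<^sup>2 = a\<^sup>2 * (b - 2 * (b + 1))"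
      by algebra
    then show ?thesis using \<open>b \<ge> 0\<close> by (simp add: eq_divide_eq)
  qed
  also have "\<dots> < 0"
    using \<open>a > 0\<close> \<open>b \<ge> 0\<close> by (intro divide_neg_pos mult_pos_neg) auto
  finally show False by simp
qed

end

lemma self_adjoint_uminus: "self_adjoint A \<Longrightarrow> self_adjoint (\<lambda>x. - A x)"
  by (simp add: self_adjoint_def linear_compose_neg)

lemma eigenvalues_uminus: "eigenvalues (\<lambda>x. - A x) = uminus ` eigenvalues A"
proof -
  have uminus_image_iff: "l \<in> uminus ` S \<longleftrightarrow> - l \<in> S" for l :: real and S
    by (metis image_iff minus_minus)
  have "- A v = l *\<^sub>R v \<longleftrightarrow> A v = (- l) *\<^sub>R v" for l v
    by (metis minus_minus scaleR_minus_left)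
  then have "l \<in> eigenvalues (\<lambda>x. - A x) \<longleftrightarrow> - l \<in> eigenvalues A" for l
    unfolding eigenvalues_def by blast
  then show ?thesis
    by (simp add: set_eq_iff uminus_image_iff)
qed

context self_adjoint
begin

lemma scaleR_minus_self_adjoint: "self_adjoint (\<lambda>x. m *\<^sub>R x - A x)"
proof (rule self_adjoint.intro)
  show "linear (\<lambda>x. m *\<^sub>R x - A x)"
    by (rule linear_compose_sub[OF linear_scale_self linear])
  show "(m *\<^sub>R x - A x) \<bullet> y = x \<bullet> (m *\<^sub>R y - A y)" for x y
    by (simp add: inner_diff_left inner_diff_right sym)
qed

text \<open>Compactness gives a maximizer \<open>v\<close> of the form on the unit sphere, with
  value \<open>m\<close>. The form of \<open>m *\<^sub>R x - A x\<close> is then nonnegative and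
  vanishes at \<open>v\<close>, so \<open>nonneg_form_kernel\<close> turns \<open>v\<close> into an
  eigenvector.\<close>

lemma exists_top_eigenvalue:
  obtains m where "m \<in> eigenvalues A" "\<And>w. w \<bullet> A w \<le> m * (w \<bullet> w)"
proof -
  have "sphere 0 1 \<noteq> ({}::'a set)" by simp
  moreover have "continuous_on (sphere 0 1) (\<lambda>w. w \<bullet> A w)"
    by (intro continuous_intros linear_continuous_on linear_conv_bounded_linear[THEN iffD1] linear)
  ultimately have "\<exists>v\<in>sphere 0 1. \<forall>w\<in>sphere 0 1. w \<bullet> A w \<le> v \<bullet> A v"
    by (rule continuous_attains_sup[OF compact_sphere])
  then obtain v where v: "v \<in> sphere 0 1" "\<And>w. w \<in> sphere 0 1 \<Longrightarrow> w \<bullet> A w \<le> v \<bullet> A v"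
    by blast
  define m where "m = v \<bullet> A v"
  have bd: "w \<bullet> A w \<le> m * (w \<bullet> w)" for w
  proof (cases "w = 0")
    case False
    have "(w /\<^sub>R norm w) \<bullet> A (w /\<^sub>R norm w) \<le> m"
      unfolding m_def using False by (intro v(2)) simp
    then have "(w \<bullet> A w) / (norm w)\<^sup>2 \<le> m"
      by (simp add: linear_scale[OF linear] power2_eq_square divide_inverse mult.commute mult.left_commute)
    then show ?thesis using False
      by (simp add: field_simps dot_square_norm)
  qed (simp add: linear_0[OF linear])
  interpret C: self_adjoint "\<lambda>x. m *\<^sub>R x - A x" by (rule scaleR_minus_self_adjoint)
  have "m *\<^sub>R v - A v = 0"
    by (rule C.nonneg_form_kernel)
       (use bd v(1) in \<open>auto simp: inner_diff_right m_def dot_square_norm\<close>)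
  moreover have "v \<noteq> 0" using v(1) by auto
  ultimately have "m \<in> eigenvalues A" by (auto simp: eigenvalues_def)
  then show ?thesis using bd that by blast
qed

lemma Max_eigenvalues:
  shows "Max (eigenvalues A) \<in> eigenvalues A"
    and "w \<bullet> A w \<le> Max (eigenvalues A) * (norm w)\<^sup>2"
proof -
  obtain m where m: "m \<in> eigenvalues A" "\<And>w. w \<bullet> A w \<le> m * (w \<bullet> w)"
    using exists_top_eigenvalue by blast
  show "Max (eigenvalues A) \<in> eigenvalues A"
    using m eigenvalues_finite by (intro Max_in) auto
  have "m \<le> Max (eigenvalues A)" using m eigenvalues_finite by simp
  then show "w \<bullet> A w \<le> Max (eigenvalues A) * (norm w)\<^sup>2"
    using m(2)[of w] mult_right_mono[of m _ "(norm w)\<^sup>2"] by (force simp: dot_square_norm)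
qed

text \<open>Negating the map exchanges the two ends of the spectrum, so this is
  \<open>Max_eigenvalues\<close> for the negated map.\<close>

lemma Min_eigenvalues:
  shows "Min (eigenvalues A) \<in> eigenvalues A"
    and "Min (eigenvalues A) * (norm w)\<^sup>2 \<le> w \<bullet> A w"
proof -
  have ne: "eigenvalues A \<noteq> {}" using Max_eigenvalues(1) by blast
  interpret U: self_adjoint "\<lambda>x. - A x"
    by (rule self_adjoint_uminus) (rule self_adjoint_axioms)
  have "Max (uminus ` eigenvalues A) = - Min (eigenvalues A)"
    using ne eigenvalues_finite by (intro Max_eqI) auto
  then show "Min (eigenvalues A) * (norm w)\<^sup>2 \<le> w \<bullet> A w"
    using U.Max_eigenvalues(2)[of w] by (simp add: eigenvalues_uminus)
  show "Min (eigenvalues A) \<in> eigenvalues A"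
    using ne eigenvalues_finite by (intro Min_in) auto
qed

end

section \<open>Positive definite maps: comparing the weighted norms with the Euclidean one\<close>

locale pos_def = self_adjoint +
  assumes pos: "x \<noteq> 0 \<Longrightarrow> 0 < x \<bullet> A x"
begin

lemma nonneg: "0 \<le> x \<bullet> A x"
  using pos[of x] by (cases "x = 0") auto

lemma Min_eigenvalues_pos: "0 < Min (eigenvalues A)"
proof -
  obtain v where v: "v \<noteq> 0" "A v = Min (eigenvalues A) *\<^sub>R v"
    using Min_eigenvalues(1) by (auto simp: eigenvalues_def)
  moreover have "v \<bullet> v > 0" using v by simp
  ultimately show ?thesis using pos[of v] v by (metis inner_scaleR_right zero_less_mult_pos2)
qed

lemma Min_le_Max: "Min (eigenvalues A) \<le> Max (eigenvalues A)"
  using eigenvalues_finite Max_eigenvalues(1) by (simp add: Min_eigenvalues(1))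

lemma bij: "bij A"
proof -
  have "inj A"
    using pos by (force simp: linear_injective_0[OF linear])
  then show ?thesis
    using linear_injective_imp_surjective[OF linear] by (auto simp: bij_def)
qed

lemma A_inv: "A (inv A x) = x"
  using bij by (simp add: bij_is_surj surj_f_inv_f)

lemma inv_A: "inv A (A x) = x"
  using bij by (simp add: bij_is_inj)

lemma wnorm_le: "(wnorm A x)\<^sup>2 \<le> Max (eigenvalues A) * (norm x)\<^sup>2"
  using Max_eigenvalues(2) nonneg by (simp add: wnorm_def)

text \<open>This avoids square roots of \<open>A\<close> and diagonalization: expand the nonnegative
  form at \<open>m *\<^sub>R w - A w\<close> and bound its cubic term
  \<open>A w \<bullet> A (A w)\<close> by \<open>m\<close> times the squared norm of
  \<open>A w\<close>.\<close>

lemma norm_image_le: "(norm (A w))\<^sup>2 \<le> Max (eigenvalues A) * (w \<bullet> A w)"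
proof -
  define m where "m = Max (eigenvalues A)"
  have "m > 0" using Min_eigenvalues_pos Min_le_Max by (simp add: m_def)
  have "0 \<le> (m *\<^sub>R w - A w) \<bullet> A (m *\<^sub>R w - A w)" by (rule nonneg)
  also have "\<dots> = m\<^sup>2 * (w \<bullet> A w) - 2 * m * (norm (A w))\<^sup>2 + A w \<bullet> A (A w)"
    using sym[of w "A w"] sym[of "A w" w]
    unfolding power2_norm_eq_inner
    by (simp add: linear_diff[OF linear] linear_scale[OF linear] inner_diff_left inner_diff_right
        power2_eq_square algebra_simps)
  also have "\<dots> \<le> m\<^sup>2 * (w \<bullet> A w) - 2 * m * (norm (A w))\<^sup>2 + m * (norm (A w))\<^sup>2"
    using Max_eigenvalues(2)[of "A w"] by (simp add: m_def)
  finally have "m * (norm (A w))\<^sup>2 \<le> m * (m * (w \<bullet> A w))"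
    by (simp add: power2_eq_square algebra_simps)
  then show ?thesis using \<open>m > 0\<close> by (simp add: m_def)
qed

lemma norm_A_le: "norm (A u) \<le> Max (eigenvalues A) * norm u"
proof -
  define l where "l = Max (eigenvalues A)"
  have l: "l > 0" using Min_eigenvalues_pos Min_le_Max by (simp add: l_def)
  have "(norm (A u))\<^sup>2 \<le> l * (l * (norm u)\<^sup>2)"
    using norm_image_le[of u] mult_left_mono[OF Max_eigenvalues(2)[of u], of l] l
    unfolding l_def by linarith
  then have "(norm (A u))\<^sup>2 \<le> (l * norm u)\<^sup>2" by (simp add: power2_eq_square algebra_simps)
  then have "norm (A u) \<le> l * norm u"
    by (rule power2_le_imp_le) (use l in simp)
  then show ?thesis by (simp add: l_def)
qed

lemma linear_inv: "linear (inv A)"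
proof (rule linearI)
  show "inv A (x + y) = inv A x + inv A y" for x y
    using inv_A[of "inv A x + inv A y"] by (simp add: linear_add[OF linear] A_inv)
  show "inv A (c *\<^sub>R x) = c *\<^sub>R inv A x" for c x
    using inv_A[of "c *\<^sub>R inv A x"] by (simp add: linear_scale[OF linear] A_inv)
qed

lemma inv_form_nonneg: "0 \<le> v \<bullet> inv A v"
  using nonneg[of "inv A v"] by (simp add: A_inv inner_commute)

text \<open>With \<open>w = inv A v\<close> the squared dual norm of \<open>v\<close> is
  \<open>w \<bullet> A w\<close>, so this is \<open>norm_image_le\<close> at
  \<open>w\<close>.\<close>

lemma norm_le_dual: "(norm v)\<^sup>2 \<le> Max (eigenvalues A) * (wnorm (inv A) v)\<^sup>2"
  using norm_image_le[of "inv A v"] inv_form_nonneg[of v]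
  by (simp add: A_inv wnorm_def inner_commute)

text \<open>Expand the square of the norm of \<open>A w - m *\<^sub>R w\<close> for
  \<open>w = inv A v\<close> and the smallest eigenvalue \<open>m\<close>, then bound
  \<open>m\<close> times the squared norm of \<open>w\<close> by
  \<open>w \<bullet> A w\<close>.\<close>

lemma dual_le_norm: "(wnorm (inv A) v)\<^sup>2 \<le> (norm v)\<^sup>2 / Min (eigenvalues A)"
proof -
  define w where "w = inv A v"
  have v: "v = A w" by (simp add: w_def A_inv)
  define m where "m = Min (eigenvalues A)"
  have "m > 0" using Min_eigenvalues_pos by (simp add: m_def)
  have "0 \<le> (norm (A w - m *\<^sub>R w))\<^sup>2" by simp
  also have "\<dots> = (norm (A w))\<^sup>2 - 2 * m * (w \<bullet> A w) + m * (m * (norm w)\<^sup>2)"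
    using sym[of w w]
    unfolding power2_norm_eq_inner
    by (simp add: inner_diff_left inner_diff_right algebra_simps)
  also have "\<dots> \<le> (norm (A w))\<^sup>2 - 2 * m * (w \<bullet> A w) + m * (w \<bullet> A w)"
    using Min_eigenvalues(2)[of w] \<open>m > 0\<close> by (simp add: m_def)
  finally have "m * (w \<bullet> A w) \<le> (norm v)\<^sup>2" by (simp add: v)
  moreover have "(wnorm (inv A) v)\<^sup>2 = w \<bullet> A w"
    using inv_form_nonneg[of v] by (simp add: wnorm_def v inv_A inner_commute nonneg)
  ultimately show ?thesis using \<open>m > 0\<close> by (simp add: m_def field_simps)
qed

end

lemma pos_def_block_diag:
  assumes "sym_pos_def B1" "sym_pos_def B2"
  shows "pos_def (block_diag B1 B2)"
proof (rule pos_def.intro; (rule self_adjoint.intro | rule pos_def_axioms.intro)?)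
  show "linear (block_diag B1 B2)"
    by (rule linearI) (auto simp: block_diag_def matrix_vector_right_distrib matrix_vector_mult_scaleR)
  have s: "(B *v x) \<bullet> y = x \<bullet> (B *v y)" if "sym_pos_def B" for B :: "real^'k^'k" and x y
    using that by (metis dot_lmul_matrix inner_commute sym_pos_def_def vector_transpose_matrix)
  show "block_diag B1 B2 x \<bullet> y = x \<bullet> block_diag B1 B2 y" for x y
    using assms by (simp add: block_diag_def inner_prod_def s)
  have nn: "v \<bullet> (B *v v) \<ge> 0" if "sym_pos_def B" for B :: "real^'k^'k" and v
    using that by (cases "v = 0") (auto simp: sym_pos_def_def less_imp_le)
  show "0 < x \<bullet> block_diag B1 B2 x" if "x \<noteq> 0" for x
  proof -
    have "fst x \<noteq> 0 \<or> snd x \<noteq> 0" using that by (auto simp: prod_eq_iff)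
    then show ?thesis
      using assms nn[OF assms(1), of "fst x"] nn[OF assms(2), of "snd x"]
      by (auto simp: block_diag_def inner_prod_def sym_pos_def_def add_pos_nonneg add_nonneg_pos)
  qed
qed

subsection \<open>Gaussian smoothing\<close>

lemma exp_remainder_bound:
  fixes x :: real
  shows "\<bar>exp x - 1 - x\<bar> \<le> x\<^sup>2 * exp \<bar>x\<bar>"
proof -
  obtain t where t: "\<bar>t\<bar> \<le> \<bar>x\<bar>" "exp x = (\<Sum>m<2. x ^ m / fact m) + exp t / fact 2 * x ^ 2"
    using Maclaurin_exp_le by blast
  have "\<bar>exp x - 1 - x\<bar> = exp t / 2 * x\<^sup>2"
    using t(2) by (simp add: numeral_2_eq_2)
  also have "\<dots> \<le> exp \<bar>x\<bar> * x\<^sup>2"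
  proof (rule mult_right_mono)
    have "exp t \<le> exp \<bar>x\<bar>" using t(1) by simp
    then show "exp t / 2 \<le> exp \<bar>x\<bar>" using exp_gt_zero[of t] by linarith
  qed simp
  finally show ?thesis by (simp add: mult.commute)
qed

text \<open>
  The normalizing constant \<open>c\<close> is left abstract: all that is needed about it follows from the
  measure being a probability measure, so its relation to the determinant is never computed.
\<close>

locale gauss_measure = pos_def A for A :: "'a::euclidean_space \<Rightarrow> 'a" +
  fixes c :: real and \<gamma> :: "'a measure"
  assumes \<gamma>_eq: "\<gamma> = density lborel (\<lambda>u. ennreal (c * exp (- (u \<bullet> A u) / 2)))"
    and prob: "prob_space \<gamma>"
begin

sublocale G: prob_space \<gamma> by (rule prob)

lemma sets_\<gamma> [measurable_cong, simp]: "sets \<gamma> = sets borel"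
  by (simp add: \<gamma>_eq)

lemma borel_measurable_A [measurable]: "A \<in> borel_measurable borel"
  by (intro borel_measurable_continuous_onI linear_continuous_on
      linear_conv_bounded_linear[THEN iffD1] linear)

text \<open>For \<open>c\<close> at most 0, \<open>ennreal\<close> truncates the density to 0 and
  the total mass could not be 1.\<close>

lemma c_pos: "c > 0"
proof (rule ccontr)
  assume "\<not> c > 0"
  then have "c * exp (- (u \<bullet> A u) / 2) \<le> 0" for u
    by (simp add: mult_nonpos_nonneg)
  then have "\<gamma> = density lborel (\<lambda>u. 0)"
    by (simp add: \<gamma>_eq ennreal_neg)
  then have "emeasure \<gamma> (space \<gamma>) = 0"
    by (simp add: emeasure_density)
  then show False using G.emeasure_space_1 by simp
qed

section \<open>Integrability and exponential moments under the Gaussian measure\<close>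

lemma integrable_\<gamma>_iff:
  fixes F :: "'a \<Rightarrow> 'b::{banach, second_countable_topology}"
  assumes "F \<in> borel_measurable borel"
  shows "integrable \<gamma> F \<longleftrightarrow> integrable lborel (\<lambda>u. (c * exp (- (u \<bullet> A u) / 2)) *\<^sub>R F u)"
  unfolding \<gamma>_eq using assms c_pos by (intro integrable_density) auto

lemma integral_\<gamma>:
  fixes F :: "'a \<Rightarrow> 'b::{banach, second_countable_topology}"
  assumes "F \<in> borel_measurable borel"
  shows "(\<integral>u. F u \<partial>\<gamma>) = (\<integral>u. (c * exp (- (u \<bullet> A u) / 2)) *\<^sub>R F u \<partial>lborel)"
  unfolding \<gamma>_eq using assms c_pos by (intro integral_density) auto

lemma integrable_exp_form: "integrable lborel (\<lambda>u. exp (- (u \<bullet> A u) / 2))"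
proof -
  \<comment> \<open>A constant is integrable for a probability measure. Unfolding the density turns
    this one into the unnormalized Gaussian.\<close>
  have "integrable \<gamma> (\<lambda>u. 1 / c)" by simp
  then have "integrable lborel (\<lambda>u. (c * exp (- (u \<bullet> A u) / 2)) *\<^sub>R (1 / c))"
    by (subst (asm) integrable_\<gamma>_iff) auto
  then show ?thesis using c_pos by simp
qed

text \<open>Half of the Gaussian exponent remains integrable, by rescaling with
  \<open>sqrt 2\<close>. The other half is thereby free to absorb exponential factors.\<close>

lemma integrable_exp_half_form: "integrable lborel (\<lambda>u. exp (- (u \<bullet> A u) / 4))"
proof -
  \<comment> \<open>The summand 0 gives the map the shape that \<open>lborel_affine\<close>
    expects.\<close>
  let ?T = "\<lambda>x::'a. 0 + sqrt 2 *\<^sub>R x"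
  have "integrable lborel (\<lambda>u. exp (- (?T u \<bullet> A (?T u)) / 4))"
    using integrable_exp_form by (simp add: linear_scale[OF linear] flip: mult.assoc)
  then have "integrable (distr lborel borel ?T) (\<lambda>u. exp (- (u \<bullet> A u) / 4))"
    by (subst integrable_distr_eq) auto
  then have "integrable (density (distr lborel borel ?T) (\<lambda>_. ennreal (\<bar>sqrt 2\<bar> ^ DIM('a))))
      (\<lambda>u. exp (- (u \<bullet> A u) / 4))"
    by (subst integrable_density) auto
  then show ?thesis
    by (subst lborel_affine[of "sqrt 2" 0]) auto
qed

lemma integrable_exp_norm: "integrable \<gamma> (\<lambda>u. exp (m * norm u))"
proof -
  define l where "l = Min (eigenvalues A)"
  have l: "l > 0" using Min_eigenvalues_pos by (simp add: l_def)
  have bd: "exp (- (u \<bullet> A u) / 2) * exp (m * norm u) \<le> exp (m\<^sup>2 / l) * exp (- (u \<bullet> A u) / 4)" for u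
  proof -
    \<comment> \<open>Completing the square bounds \<open>m * norm u\<close> by a quarter of the
      quadratic form, the half exponent left over, plus the constant
      \<open>m\<^sup>2 / l\<close>.\<close>
    have "0 \<le> (l * norm u / 2 - m)\<^sup>2 / l" using l by simp
    also have "\<dots> = l * (norm u)\<^sup>2 / 4 - m * norm u + m\<^sup>2 / l"
      using l by (simp add: power2_eq_square field_simps)
    finally have "m * norm u \<le> (u \<bullet> A u) / 4 + m\<^sup>2 / l"
      using Min_eigenvalues(2)[of u] by (simp add: l_def)
    then show ?thesis by (simp flip: exp_add)
  qed
  have "integrable lborel (\<lambda>u. exp (- (u \<bullet> A u) / 2) * exp (m * norm u))"
    by (rule Bochner_Integration.integrable_bound
        [OF integrable_mult_right[OF integrable_exp_half_form, of "exp (m\<^sup>2 / l)"]])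
       (use bd in auto)
  then show ?thesis
    by (subst integrable_\<gamma>_iff) (auto simp: mult.assoc)
qed

text \<open>Dominated integrability with an exponential majorant. Exponentials are closed under
  products and translations, so one criterion serves all the integrands of the smoothing.\<close>

lemma integrable_exp_bound:
  fixes F :: "'a \<Rightarrow> 'b::{banach, second_countable_topology}"
  assumes "F \<in> borel_measurable borel" "\<And>u. norm (F u) \<le> K * exp (m * norm u)"
  shows "integrable \<gamma> F"
  by (rule Bochner_Integration.integrable_bound[OF integrable_mult_right[OF integrable_exp_norm, of K m]])
     (use assms in \<open>auto intro: order_trans[OF _ abs_ge_self]\<close>)

lemma integrable_norm_power: "integrable \<gamma> (\<lambda>u. norm u ^ j)"
proof (rule integrable_exp_bound[where K = 1 and m = "real j"])
  fix u :: 'a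
  have "norm u \<le> exp (norm u)" using exp_ge_add_one_self[of "norm u"] by linarith
  then have "norm u ^ j \<le> exp (norm u) ^ j" by (intro power_mono) auto
  then show "norm (norm u ^ j) \<le> 1 * exp (real j * norm u)"
    by (simp add: exp_of_nat_mult)
qed simp

text \<open>The Cameron-Martin formula: Lebesgue measure is translation invariant, and the
  exponential factor is the ratio of the translated density to the original one.\<close>

lemma integral_translate:
  fixes \<phi> :: "'a \<Rightarrow> real"
  assumes [measurable]: "\<phi> \<in> borel_measurable borel"
  shows "(\<integral>u. \<phi> (u + k) \<partial>\<gamma>) = (\<integral>u. \<phi> u * exp (k \<bullet> A u - (k \<bullet> A k) / 2) \<partial>\<gamma>)"
proof -
  have eq: "exp (- ((u - k) \<bullet> A (u - k)) / 2) = exp (- (u \<bullet> A u) / 2) * exp (k \<bullet> A u - (k \<bullet> A k) / 2)" for u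
    using sym[of u k]
    by (simp add: linear_diff[OF linear] inner_diff_left inner_diff_right inner_commute flip: exp_add)
  have "(\<integral>u. \<phi> (u + k) \<partial>\<gamma>) = (\<integral>u. (c * exp (- (u \<bullet> A u) / 2)) * \<phi> (u + k) \<partial>lborel)"
    by (subst integral_\<gamma>) auto
  also have "\<dots> = (\<integral>u. (c * exp (- ((u - k) \<bullet> A (u - k)) / 2)) * \<phi> u \<partial>distr lborel borel ((+) k))"
    by (subst integral_distr) (auto simp: add.commute)
  also have "\<dots> = (\<integral>u. (c * exp (- (u \<bullet> A u) / 2)) * (\<phi> u * exp (k \<bullet> A u - (k \<bullet> A k) / 2)) \<partial>lborel)"
    unfolding lborel_distr_plus eq by (simp add: mult_ac)
  also have "\<dots> = (\<integral>u. \<phi> u * exp (k \<bullet> A u - (k \<bullet> A k) / 2) \<partial>\<gamma>)"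
    by (subst integral_\<gamma>) auto
  finally show ?thesis .
qed

text \<open>The exponent is linear in \<open>k\<close> up to \<open>(k \<bullet> A k) / 2\<close>,
  which is already of second order, so \<open>exp_remainder_bound\<close> applies. The restriction
  on \<open>norm k\<close> keeps the majorant in \<open>u\<close> independent of
  \<open>k\<close>.\<close>

lemma exp_tilt_remainder:
  assumes "norm k \<le> 1"
  defines "\<Lambda> \<equiv> Max (eigenvalues A)"
  shows "\<bar>exp (k \<bullet> A u - (k \<bullet> A k) / 2) - 1 - k \<bullet> A u\<bar>
    \<le> (norm k)\<^sup>2 * ((\<Lambda>\<^sup>2 * exp \<Lambda> + \<Lambda>) * exp ((2 + \<Lambda>) * norm u))"
proof -
  have L: "\<Lambda> > 0" using Min_eigenvalues_pos Min_le_Max by (simp add: \<Lambda>_def)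
  define a where "a = k \<bullet> A u"
  define b where "b = (k \<bullet> A k) / 2"
  define x where "x = a - b"
  have a: "\<bar>a\<bar> \<le> \<Lambda> * norm k * norm u"
    unfolding a_def using Cauchy_Schwarz_ineq2[of k "A u"]
      mult_left_mono[OF norm_A_le[of u] norm_ge_zero[of k]] by (simp add: \<Lambda>_def mult_ac)
  have b: "0 \<le> b" "b \<le> \<Lambda> * (norm k)\<^sup>2"
    using nonneg[of k] Max_eigenvalues(2)[of k] by (auto simp: b_def \<Lambda>_def)
  have "(norm k)\<^sup>2 \<le> norm k"
    using assms(1) by (simp add: power2_eq_square mult_left_le)
  then have "\<Lambda> * (norm k)\<^sup>2 \<le> \<Lambda> * norm k" using L by simp
  with a b have x: "\<bar>x\<bar> \<le> \<Lambda> * norm k * (norm u + 1)"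
    by (simp add: x_def algebra_simps)
  also have "\<dots> \<le> \<Lambda> * (norm u + 1)"
    using assms(1) L by (simp add: mult_left_le mult_right_mono)
  finally have x': "exp \<bar>x\<bar> \<le> exp (\<Lambda> * (norm u + 1))" by simp
  \<comment> \<open>Replacing the polynomial factor by an exponential keeps the majorant within the
    reach of \<open>integrable_exp_norm\<close>.\<close>
  have u: "norm u + 1 \<le> exp (norm u)" using exp_ge_add_one_self[of "norm u"] by linarith
  have "x\<^sup>2 \<le> (\<Lambda> * norm k * (norm u + 1))\<^sup>2"
    using x by (metis abs_ge_zero power2_abs power_mono)
  also have "\<dots> \<le> (\<Lambda> * norm k * exp (norm u))\<^sup>2"
    using L u by (intro power_mono mult_left_mono) auto
  finally have x2: "x\<^sup>2 \<le> (\<Lambda> * norm k * exp (norm u))\<^sup>2" .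
  have "\<bar>exp x - 1 - a\<bar> \<le> \<bar>exp x - 1 - x\<bar> + b"
    using b by (simp add: x_def)
  also have "\<dots> \<le> x\<^sup>2 * exp \<bar>x\<bar> + \<Lambda> * (norm k)\<^sup>2"
    using exp_remainder_bound[of x] b by linarith
  also have "\<dots> \<le> (\<Lambda> * norm k * exp (norm u))\<^sup>2 * exp (\<Lambda> * (norm u + 1)) + \<Lambda> * (norm k)\<^sup>2"
    using x2 x' by (intro add_right_mono mult_mono) auto
  also have "\<dots> = (norm k)\<^sup>2 * (\<Lambda>\<^sup>2 * exp \<Lambda> * exp ((2 + \<Lambda>) * norm u) + \<Lambda>)"
    by (simp add: power_mult_distrib algebra_simps exp_add flip: exp_of_nat_mult)
  also have "\<dots> \<le> (norm k)\<^sup>2 * ((\<Lambda>\<^sup>2 * exp \<Lambda> + \<Lambda>) * exp ((2 + \<Lambda>) * norm u))"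
    using L by (intro mult_left_mono) (auto simp: distrib_right)
  finally show ?thesis by (simp add: x_def a_def b_def)
qed

text \<open>
  Translating \<open>u\<close> moves the increment of \<open>z\<close> from \<open>f\<close> to the density, which is smooth. Subtracting
  \<open>f z\<close> from the integrand changes nothing in the increment but makes it \<open>O(norm u)\<close>.
\<close>

theorem GDERIV_smoothing:
  fixes f :: "'a \<Rightarrow> real"
  assumes lip: "\<And>x y. \<bar>f x - f y\<bar> \<le> C * norm (x - y)" and "C \<ge> 0" and "\<mu> > 0"
  shows "GDERIV (\<lambda>z. \<integral>u. f (z + \<mu> *\<^sub>R u) \<partial>\<gamma>) z :> (\<integral>u. ((f (z + \<mu> *\<^sub>R u) - f z) / \<mu>) *\<^sub>R A u \<partial>\<gamma>)"
proof -
  define \<Lambda> where "\<Lambda> = Max (eigenvalues A)"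
  have L: "\<Lambda> > 0" using Min_eigenvalues_pos Min_le_Max by (simp add: \<Lambda>_def)
  have "continuous_on UNIV f"
    using lip by (intro lipschitz_on_continuous_on[OF lipschitz_onI, of _ _ C])
      (auto simp: dist_norm \<open>C \<ge> 0\<close>)
  then have [measurable]: "f \<in> borel_measurable borel"
    by (rule borel_measurable_continuous_onI)
  define D where "D = (\<integral>u. ((f (z + \<mu> *\<^sub>R u) - f z) / \<mu>) *\<^sub>R A u \<partial>\<gamma>)"
  define \<phi> where "\<phi> u = f (z + \<mu> *\<^sub>R u) - f z" for u
  define K where "K = C * \<mu> * (\<Lambda>\<^sup>2 * exp \<Lambda> + \<Lambda>)"
  have [measurable]: "\<phi> \<in> borel_measurable borel" unfolding \<phi>_def by measurable
  have ne: "norm u \<le> exp (norm u)" for u :: 'a using exp_ge_add_one_self[of "norm u"] by linarith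
  have \<phi>_le: "\<bar>\<phi> u\<bar> \<le> C * \<mu> * norm u" for u
    using lip[of "z + \<mu> *\<^sub>R u" z] \<open>\<mu> > 0\<close> by (simp add: \<phi>_def)
  then have \<phi>_exp: "\<bar>\<phi> u\<bar> \<le> C * \<mu> * exp (norm u)" for u
    using mult_left_mono[OF ne[of u], of "C * \<mu>"] \<open>C \<ge> 0\<close> \<open>\<mu> > 0\<close> order_trans by fastforce
  have intA: "integrable \<gamma> (\<lambda>u. (\<phi> u / \<mu>) *\<^sub>R A u)"
  proof (rule integrable_exp_bound[where K = "C * \<Lambda>" and m = 2])
    fix u
    have "norm ((\<phi> u / \<mu>) *\<^sub>R A u) \<le> (C * exp (norm u)) * (\<Lambda> * exp (norm u))"
      unfolding norm_scaleR
    proof (rule mult_mono)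
      show "\<bar>\<phi> u / \<mu>\<bar> \<le> C * exp (norm u)"
        using \<phi>_exp[of u] \<open>\<mu> > 0\<close> by (simp add: abs_divide divide_le_eq mult_ac)
      show "norm (A u) \<le> \<Lambda> * exp (norm u)"
        using norm_A_le[of u] mult_left_mono[OF ne[of u], of \<Lambda>] L unfolding \<Lambda>_def by linarith
    qed (use \<open>C \<ge> 0\<close> in auto)
    then show "norm ((\<phi> u / \<mu>) *\<^sub>R A u) \<le> C * \<Lambda> * exp (2 * norm u)"
      by (simp add: mult_ac flip: exp_add)
  qed simp
  have intT: "integrable \<gamma> (\<lambda>u. \<phi> u * exp (k \<bullet> A u - (k \<bullet> A k) / 2))" if "norm k \<le> 1" for k
  proof (rule integrable_exp_bound[where K = "C * \<mu>" and m = "1 + \<Lambda>"])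
    fix u
    have "\<bar>k \<bullet> A u\<bar> \<le> norm k * norm (A u)" by (rule Cauchy_Schwarz_ineq2)
    also have "\<dots> \<le> 1 * (\<Lambda> * norm u)"
      using that norm_A_le[of u] by (intro mult_mono) (auto simp: \<Lambda>_def)
    finally have "k \<bullet> A u - (k \<bullet> A k) / 2 \<le> \<Lambda> * norm u" using nonneg[of k] by linarith
    then have "\<bar>\<phi> u\<bar> * exp (k \<bullet> A u - (k \<bullet> A k) / 2) \<le> (C * \<mu> * exp (norm u)) * exp (\<Lambda> * norm u)"
      using \<phi>_exp[of u] \<open>C \<ge> 0\<close> \<open>\<mu> > 0\<close> by (intro mult_mono) auto
    then show "norm (\<phi> u * exp (k \<bullet> A u - (k \<bullet> A k) / 2)) \<le> C * \<mu> * exp ((1 + \<Lambda>) * norm u)"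
      by (simp add: abs_mult algebra_simps exp_add)
  qed simp
  have int\<phi>: "integrable \<gamma> (\<lambda>u. \<phi> u)"
    using \<phi>_exp by (intro integrable_exp_bound[where K = "C * \<mu>" and m = 1]) auto
  have int\<phi>k: "integrable \<gamma> (\<lambda>u. \<phi> (u + k))" if "norm k \<le> 1" for k
  proof (rule integrable_exp_bound[where K = "C * \<mu> * exp 1" and m = 1])
    fix u
    have "norm (u + k) \<le> norm u + 1" using norm_triangle_ineq[of u k] that by linarith
    then have "C * \<mu> * exp (norm (u + k)) \<le> C * \<mu> * exp (norm u + 1)"
      using \<open>C \<ge> 0\<close> \<open>\<mu> > 0\<close> by (intro mult_left_mono) auto
    then show "norm (\<phi> (u + k)) \<le> C * \<mu> * exp 1 * exp (1 * norm u)"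
      using \<phi>_exp[of "u + k"] by (simp add: exp_add mult_ac)
  qed simp
  have intR: "integrable \<gamma> (\<lambda>u. \<phi> u * (k \<bullet> A u))" for k
    using integrable_inner_right[OF intA, of "\<mu> *\<^sub>R k"] \<open>\<mu> > 0\<close> by (simp add: inner_commute)
  have sm: "(\<integral>u. f (z + \<mu> *\<^sub>R k + \<mu> *\<^sub>R u) \<partial>\<gamma>) = f z + (\<integral>u. \<phi> (u + k) \<partial>\<gamma>)" if "norm k \<le> 1" for k
  proof -
    have "(\<integral>u. f (z + \<mu> *\<^sub>R k + \<mu> *\<^sub>R u) \<partial>\<gamma>) = (\<integral>u. f z + \<phi> (u + k) \<partial>\<gamma>)"
      by (simp add: \<phi>_def scaleR_right_distrib add_ac)
    also have "\<dots> = f z + (\<integral>u. \<phi> (u + k) \<partial>\<gamma>)"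
      using int\<phi>k[OF that] by (subst Bochner_Integration.integral_add) (auto simp: G.prob_space)
    finally show ?thesis .
  qed
  \<comment> \<open>The rate \<open>3 + \<Lambda>\<close> adds 1 from the growth bound
    \<open>\<phi>_exp\<close> to \<open>2 + \<Lambda>\<close> from
    \<open>exp_tilt_remainder\<close>.\<close>
  define E where "E = (\<integral>u. exp ((3 + \<Lambda>) * norm u) \<partial>\<gamma>)"
  define g where "g z = (\<integral>u. f (z + \<mu> *\<^sub>R u) \<partial>\<gamma>)" for z
  \<comment> \<open>Writing the increment of \<open>z\<close> as \<open>\<mu> *\<^sub>R k\<close>
    makes it a translation of \<open>u\<close> by \<open>k\<close>, so
    \<open>integral_translate\<close> applies and the error is quadratic in
    \<open>k\<close>.\<close>
  have rem: "\<bar>g (z + \<mu> *\<^sub>R k) - g z - (\<mu> *\<^sub>R k) \<bullet> D\<bar> \<le> (norm k)\<^sup>2 * (K * E)" if k: "norm k \<le> 1" for k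
  proof -
    let ?e = "\<lambda>u. exp (k \<bullet> A u - (k \<bullet> A k) / 2)"
    have "(\<mu> *\<^sub>R k) \<bullet> D = (\<integral>u. (\<mu> *\<^sub>R k) \<bullet> ((\<phi> u / \<mu>) *\<^sub>R A u) \<partial>\<gamma>)"
      unfolding D_def using intA by (subst integral_inner_right) (simp_all add: \<phi>_def)
    also have "\<dots> = (\<integral>u. \<phi> u * (k \<bullet> A u) \<partial>\<gamma>)" using \<open>\<mu> > 0\<close> by simp
    finally have "g (z + \<mu> *\<^sub>R k) - g z - (\<mu> *\<^sub>R k) \<bullet> D =
        (\<integral>u. \<phi> u * ?e u \<partial>\<gamma>) - (\<integral>u. \<phi> u \<partial>\<gamma>) - (\<integral>u. \<phi> u * (k \<bullet> A u) \<partial>\<gamma>)"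
      using sm[OF k] sm[of 0] by (simp add: g_def integral_translate)
    also have "\<dots> = (\<integral>u. \<phi> u * ?e u - \<phi> u - \<phi> u * (k \<bullet> A u) \<partial>\<gamma>)"
      using intT[OF k] int\<phi> intR[of k] by simp
    also have "\<bar>\<dots>\<bar> \<le> (\<integral>u. (norm k)\<^sup>2 * (K * exp ((3 + \<Lambda>) * norm u)) \<partial>\<gamma>)"
    proof (rule integral_abs_bound_integral)
      fix u
      have "\<phi> u * ?e u - \<phi> u - \<phi> u * (k \<bullet> A u) = \<phi> u * (?e u - 1 - k \<bullet> A u)"
        by (simp add: algebra_simps)
      also have "\<bar>\<dots>\<bar> \<le> (C * \<mu> * exp (norm u)) *
          ((norm k)\<^sup>2 * ((\<Lambda>\<^sup>2 * exp \<Lambda> + \<Lambda>) * exp ((2 + \<Lambda>) * norm u)))"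
        unfolding abs_mult using \<phi>_exp[of u] exp_tilt_remainder[OF k, of u] \<open>C \<ge> 0\<close> \<open>\<mu> > 0\<close>
        by (intro mult_mono) (auto simp: \<Lambda>_def)
      also have "\<dots> = (norm k)\<^sup>2 * (K * exp ((3 + \<Lambda>) * norm u))"
      proof -
        have "exp ((3 + \<Lambda>) * norm u) = exp (norm u) * exp ((2 + \<Lambda>) * norm u)"
          by (simp add: algebra_simps flip: exp_add)
        then show ?thesis by (simp add: K_def mult_ac)
      qed
      finally show "\<bar>\<phi> u * ?e u - \<phi> u - \<phi> u * (k \<bullet> A u)\<bar> \<le> \<dots>" .
    qed (use intT[OF k] int\<phi> intR[of k] integrable_exp_norm in auto)
    also have "\<dots> = (norm k)\<^sup>2 * (K * E)" by (simp add: E_def)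
    finally show ?thesis .
  qed
  \<comment> \<open>Back to the increment \<open>h\<close>, with
    \<open>k = h /\<^sub>R \<mu>\<close>; the bound \<open>norm h \<le> \<mu>\<close> is what gives
    \<open>norm k \<le> 1\<close>.\<close>
  have rem': "\<bar>g (z + h) - g z - h \<bullet> D\<bar> / norm h \<le> norm h * (K * E / \<mu>\<^sup>2)" if "norm h \<le> \<mu>" for h
  proof (cases "h = 0")
    case False
    have "\<bar>g (z + h) - g z - h \<bullet> D\<bar> \<le> (norm (h /\<^sub>R \<mu>))\<^sup>2 * (K * E)"
      using rem[of "h /\<^sub>R \<mu>"] that \<open>\<mu> > 0\<close> by (simp add: field_simps)
    also have "\<dots> = norm h * (K * E / \<mu>\<^sup>2) * norm h"
      using \<open>\<mu> > 0\<close> by (simp add: power2_eq_square field_simps)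
    finally show ?thesis using False by (simp add: divide_le_eq)
  qed simp
  have "((\<lambda>h. norm (g (z + h) - g z - h \<bullet> D) / norm h) \<longlongrightarrow> 0) (at 0)"
  proof (rule Lim_null_comparison)
    have "\<forall>\<^sub>F h in at (0::'a). norm h < \<mu>"
      using \<open>\<mu> > 0\<close> by (auto simp: eventually_at dist_norm intro!: exI[of _ \<mu>])
    then show "\<forall>\<^sub>F h in at 0. norm (norm (g (z + h) - g z - h \<bullet> D) / norm h) \<le> norm h * (K * E / \<mu>\<^sup>2)"
      by eventually_elim (use rem' in auto)
    show "((\<lambda>h. norm h * (K * E / \<mu>\<^sup>2)) \<longlongrightarrow> 0) (at (0::'a))"
      by (intro tendsto_eq_intros) auto
  qed
  then have "GDERIV g z :> D"
    by (simp add: gderiv_def has_derivative_at bounded_linear_inner_left)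
  then show ?thesis unfolding g_def D_def .
qed

end

subsection \<open>Square-integrable noise\<close>

definition sq_int :: "'w measure \<Rightarrow> ('w \<Rightarrow> 'a::euclidean_space) \<Rightarrow> bool"
  where "sq_int M X \<longleftrightarrow> X \<in> borel_measurable M \<and> integrable M (\<lambda>\<omega>. (norm (X \<omega>))\<^sup>2)"

lemma sq_intD:
  assumes "sq_int M X"
  shows "X \<in> borel_measurable M" "integrable M (\<lambda>\<omega>. (norm (X \<omega>))\<^sup>2)"
  using assms by (auto simp: sq_int_def)

lemma sq_int_bound:
  assumes "sq_int M X" "Y \<in> borel_measurable M" "\<And>\<omega>. \<omega> \<in> space M \<Longrightarrow> norm (Y \<omega>) \<le> norm (X \<omega>)"
  shows "sq_int M Y"
proof -
  note [measurable] = assms(2)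
  have "integrable M (\<lambda>\<omega>. (norm (Y \<omega>))\<^sup>2)"
    by (rule Bochner_Integration.integrable_bound[OF sq_intD(2)[OF assms(1)]])
       (use assms(3) in \<open>auto intro!: AE_I2 power_mono\<close>)
  then show ?thesis using assms(2) by (simp add: sq_int_def)
qed

lemma sq_int_scaleR: "sq_int M X \<Longrightarrow> sq_int M (\<lambda>\<omega>. c *\<^sub>R X \<omega>)"
  by (auto simp: sq_int_def power_mult_distrib)

lemma sq_int_cong: "(\<And>\<omega>. \<omega> \<in> space M \<Longrightarrow> X \<omega> = Y \<omega>) \<Longrightarrow> sq_int M X \<longleftrightarrow> sq_int M Y"
  unfolding sq_int_def
  by (intro arg_cong2[where f = "(\<and>)"] measurable_cong Bochner_Integration.integrable_cong) auto

lemma norm_diff_square_le: "(norm (x - y))\<^sup>2 \<le> 2 * (norm x)\<^sup>2 + 2 * (norm y)\<^sup>2"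
  for x y :: "'a::real_inner"
proof -
  have "0 \<le> (norm (x + y))\<^sup>2" by simp
  then show ?thesis
    unfolding power2_norm_eq_inner by (simp add: inner_add inner_diff inner_commute)
qed

lemma sq_int_diff:
  assumes "sq_int M X" "sq_int M Y"
  shows "sq_int M (\<lambda>\<omega>. X \<omega> - Y \<omega>)"
proof -
  note [measurable] = assms[THEN sq_intD(1)]
  have "integrable M (\<lambda>\<omega>. (norm (X \<omega> - Y \<omega>))\<^sup>2)"
    by (rule Bochner_Integration.integrable_bound[of M "\<lambda>\<omega>. 2 * (norm (X \<omega>))\<^sup>2 + 2 * (norm (Y \<omega>))\<^sup>2"])
       (use assms[THEN sq_intD(2)] in \<open>auto simp: norm_diff_square_le\<close>)
  then show ?thesis by (simp add: sq_int_def)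
qed

lemma sq_int_inner:
  fixes X Y :: "'w \<Rightarrow> 'a::euclidean_space"
  assumes "sq_int M X" "sq_int M Y"
  shows "integrable M (\<lambda>\<omega>. X \<omega> \<bullet> Y \<omega>)"
proof -
  note [measurable] = assms[THEN sq_intD(1)]
  have le: "\<bar>x \<bullet> y\<bar> \<le> (norm x)\<^sup>2 + (norm y)\<^sup>2" for x y :: 'a
  proof -
    have "0 \<le> (norm (x + y))\<^sup>2" "0 \<le> (norm (x - y))\<^sup>2" "0 \<le> x \<bullet> x" "0 \<le> y \<bullet> y" by simp_all
    then show ?thesis
      unfolding power2_norm_eq_inner by (simp add: inner_add inner_diff inner_commute)
  qed
  show ?thesis
    by (rule Bochner_Integration.integrable_bound
        [OF Bochner_Integration.integrable_add[OF assms[THEN sq_intD(2)]]])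
       (use le in auto)
qed

lemma (in prob_space) sq_int_const: "sq_int M (\<lambda>\<omega>. c)"
  by (simp add: sq_int_def)

section \<open>Averaging over a fresh sample while the past is fixed\<close>

lemma (in prob_space) expectation_indep:
  fixes h :: "'b \<times> 'b \<Rightarrow> real"
  assumes ind: "indep_var S R T U" and [measurable]: "h \<in> borel_measurable (S \<Otimes>\<^sub>M T)"
    and int: "integrable M (\<lambda>\<omega>. h (R \<omega>, U \<omega>))"
  shows "expectation (\<lambda>\<omega>. h (R \<omega>, U \<omega>)) = expectation (\<lambda>\<omega>. \<integral>v. h (R \<omega>, v) \<partial>distr M T U)"
    and "integrable M (\<lambda>\<omega>. \<integral>v. h (R \<omega>, v) \<partial>distr M T U)"
proof -
  have [measurable]: "R \<in> measurable M S" "U \<in> measurable M T"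
    using indep_var_rv1[OF ind] indep_var_rv2[OF ind] by auto
  interpret X: prob_space "distr M S R" by (rule prob_space_distr) measurable
  interpret Y: prob_space "distr M T U" by (rule prob_space_distr) measurable
  interpret XY: pair_prob_space "distr M S R" "distr M T U" ..
  \<comment> \<open>Independence makes the joint law a product, so Fubini can integrate out
    \<open>U\<close> for fixed \<open>R\<close>. This plays the role of conditioning on
    \<open>R\<close>.\<close>
  have eq: "distr M S R \<Otimes>\<^sub>M distr M T U = distr M (S \<Otimes>\<^sub>M T) (\<lambda>\<omega>. (R \<omega>, U \<omega>))"
    using ind by (simp add: indep_var_distribution_eq)
  have int': "integrable (distr M S R \<Otimes>\<^sub>M distr M T U) h"
    unfolding eq using int by (subst integrable_distr_eq) auto
  have m [measurable]: "(\<lambda>x. \<integral>v. h (x, v) \<partial>distr M T U) \<in> borel_measurable S"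
    by (intro Y.borel_measurable_lebesgue_integral) simp
  have "expectation (\<lambda>\<omega>. h (R \<omega>, U \<omega>)) = (\<integral>x. h x \<partial>(distr M S R \<Otimes>\<^sub>M distr M T U))"
    unfolding eq by (subst integral_distr) auto
  also have "\<dots> = (\<integral>x. \<integral>v. h (x, v) \<partial>distr M T U \<partial>distr M S R)"
    using XY.integral_fst'[OF int'] by simp
  also have "\<dots> = expectation (\<lambda>\<omega>. \<integral>v. h (R \<omega>, v) \<partial>distr M T U)"
    by (subst integral_distr) auto
  finally show "expectation (\<lambda>\<omega>. h (R \<omega>, U \<omega>)) = expectation (\<lambda>\<omega>. \<integral>v. h (R \<omega>, v) \<partial>distr M T U)" .
  have "integrable (distr M S R) (\<lambda>x. \<integral>v. h (x, v) \<partial>distr M T U)"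
    using XY.integrable_fst'[OF int'] by simp
  then show "integrable M (\<lambda>\<omega>. \<integral>v. h (R \<omega>, v) \<partial>distr M T U)"
    by (subst (asm) integrable_distr_eq) auto
qed

text \<open>An unbiased estimator \<open>G\<close> of \<open>F\<close> with bounded variance. The
  envelope \<open>g\<close> is the same for all points \<open>w\<close>, so oracle values at random
  points are square integrable whatever the moments of those points.\<close>

locale stochastic_oracle =
  fixes \<gamma> :: "'a::euclidean_space measure" and G :: "'a \<Rightarrow> 'a \<Rightarrow> 'a" and F :: "'a \<Rightarrow> 'a"
    and g :: "'a \<Rightarrow> real" and s :: real
  assumes prob: "prob_space \<gamma>" and sets_\<gamma> [measurable_cong, simp]: "sets \<gamma> = sets borel"
    and G_meas: "case_prod G \<in> borel_measurable (borel \<Otimes>\<^sub>M borel)"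
    and F_meas [measurable]: "F \<in> borel_measurable borel"
    and g_meas [measurable]: "g \<in> borel_measurable borel"
    and G_bound: "norm (G w u) \<le> g u"
    and g_int: "integrable \<gamma> (\<lambda>u. (g u)\<^sup>2)"
    and mean: "(\<integral>u. G w u \<partial>\<gamma>) = F w"
    and variance: "(\<integral>u. (norm (G w u - F w))\<^sup>2 \<partial>\<gamma>) \<le> s"
begin

interpretation prob_space \<gamma> by (rule prob)

lemma measurable_G [measurable (raw)]:
  assumes "X \<in> borel_measurable M" "Y \<in> borel_measurable M"
  shows "(\<lambda>\<omega>. G (X \<omega>) (Y \<omega>)) \<in> borel_measurable M"
  using measurable_compose[OF measurable_Pair[OF assms] G_meas] by simp

lemma g_nonneg: "0 \<le> g u"
  using G_bound[of undefined u] norm_ge_zero order_trans by blast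

lemma integrable_G: "integrable \<gamma> (\<lambda>u. G w u)"
proof -
  have "integrable \<gamma> g"
    using g_int by (rule square_integrable_imp_integrable[rotated]) simp
  then show ?thesis
    by (rule Bochner_Integration.integrable_bound) (use G_bound g_nonneg in auto)
qed

text \<open>Unbiasedness makes \<open>F\<close> an average of vectors below the envelope, so
  \<open>F\<close> is bounded and thus square integrable along any random point.\<close>

lemma norm_F_le: "norm (F w) \<le> (\<integral>u. g u \<partial>\<gamma>)"
proof -
  have "norm (F w) \<le> (\<integral>u. norm (G w u) \<partial>\<gamma>)"
    unfolding mean[symmetric] by (rule integral_norm_bound)
  also have "\<dots> \<le> (\<integral>u. g u \<partial>\<gamma>)"
    using integrable_norm[OF integrable_G] square_integrable_imp_integrable[OF _ g_int] G_bound
    by (rule integral_mono) simp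
  finally show ?thesis .
qed

end

text \<open>One oracle call: \<open>R\<close> is the past, \<open>a\<close> computes the query point
  from it, \<open>V\<close> carries the fresh randomness and \<open>e\<close> extracts the sampled
  direction.\<close>

locale oracle_sample = M: prob_space M + stochastic_oracle \<gamma> G F g s
  for M :: "'w measure" and \<gamma> :: "'a::euclidean_space measure" and G F g s +
  fixes S T :: "'b measure" and R V :: "'w \<Rightarrow> 'b" and e :: "'b \<Rightarrow> 'a" and a :: "'b \<Rightarrow> 'a"
  assumes indep: "M.indep_var S R T V"
    and e_meas [measurable]: "e \<in> borel_measurable T"
    and a_meas [measurable]: "a \<in> borel_measurable S"
    and law: "distr M borel (\<lambda>\<omega>. e (V \<omega>)) = \<gamma>"
begin

lemma R_meas [measurable]: "R \<in> measurable M S"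
  and V_meas [measurable]: "V \<in> measurable M T"
  using M.indep_var_rv1[OF indep] M.indep_var_rv2[OF indep] by auto

lemma distr_V: "distr (distr M T V) borel e = \<gamma>"
  using law by (subst distr_distr) (auto simp: comp_def)

lemma sq_int_sample: "sq_int M (\<lambda>\<omega>. G (a (R \<omega>)) (e (V \<omega>)))"
proof -
  have "integrable M (\<lambda>\<omega>. (g (e (V \<omega>)))\<^sup>2)"
    using g_int unfolding law[symmetric] by (subst (asm) integrable_distr_eq) auto
  then have "sq_int M (\<lambda>\<omega>. g (e (V \<omega>)))" by (simp add: sq_int_def)
  then show ?thesis
    by (rule sq_int_bound) (use G_bound g_nonneg in auto)
qed

lemma sq_int_F: "sq_int M (\<lambda>\<omega>. F (a (R \<omega>)))"
  \<comment> \<open>The bound of \<open>norm_F_le\<close> is realized as a constant vector, a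
    multiple of a unit basis vector, because \<open>sq_int_bound\<close> compares norms of two
    random vectors.\<close>
  by (rule sq_int_bound[OF M.sq_int_const[of "(\<integral>u. g u \<partial>\<gamma>) *\<^sub>R (SOME b. b \<in> Basis)"]])
     (auto simp: SOME_Basis norm_Basis intro: order_trans[OF norm_F_le abs_ge_self])

lemma sq_int_noise: "sq_int M (\<lambda>\<omega>. G (a (R \<omega>)) (e (V \<omega>)) - F (a (R \<omega>)))"
  by (intro sq_int_diff sq_int_sample sq_int_F)

lemma integral_distr_V:
  fixes k :: "'a \<Rightarrow> real"
  assumes [measurable]: "k \<in> borel_measurable borel"
  shows "(\<integral>v. k (e v) \<partial>distr M T V) = (\<integral>u. k u \<partial>\<gamma>)"
  unfolding distr_V[symmetric] by (subst (2) integral_distr) auto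

lemma expectation_noise_square:
  "M.expectation (\<lambda>\<omega>. (norm (G (a (R \<omega>)) (e (V \<omega>)) - F (a (R \<omega>))))\<^sup>2) \<le> s"
proof -
  let ?h = "\<lambda>(r, v). (norm (G (a r) (e v) - F (a r)))\<^sup>2"
  have m: "?h \<in> borel_measurable (S \<Otimes>\<^sub>M T)" by measurable
  have i: "integrable M (\<lambda>\<omega>. ?h (R \<omega>, V \<omega>))"
    using sq_intD(2)[OF sq_int_noise] by simp
  have "M.expectation (\<lambda>\<omega>. ?h (R \<omega>, V \<omega>)) = M.expectation (\<lambda>\<omega>. \<integral>v. ?h (R \<omega>, v) \<partial>distr M T V)"
    by (rule M.expectation_indep(1)[OF indep m i])
  also have "\<dots> \<le> M.expectation (\<lambda>\<omega>. s)"
  proof (rule integral_mono)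
    show "integrable M (\<lambda>\<omega>. \<integral>v. ?h (R \<omega>, v) \<partial>distr M T V)"
      by (rule M.expectation_indep(2)[OF indep m i])
    show "(\<integral>v. ?h (R \<omega>, v) \<partial>distr M T V) \<le> s" for \<omega>
      using variance[of "a (R \<omega>)"]
        integral_distr_V[of "\<lambda>u. (norm (G (a (R \<omega>)) u - F (a (R \<omega>))))\<^sup>2"] by simp
  qed simp
  finally show ?thesis by (simp add: M.prob_space)
qed

text \<open>Once the past is fixed, \<open>b (R \<omega>)\<close> is a constant vector and the noise
  is centred, so the inner integral is 0.\<close>

lemma expectation_noise_inner:
  assumes b [measurable]: "b \<in> borel_measurable S" and "sq_int M (\<lambda>\<omega>. b (R \<omega>))"
  shows "M.expectation (\<lambda>\<omega>. (G (a (R \<omega>)) (e (V \<omega>)) - F (a (R \<omega>))) \<bullet> b (R \<omega>)) = 0"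
proof -
  interpret \<gamma>: prob_space \<gamma> by (rule prob)
  let ?h = "\<lambda>(r, v). (G (a r) (e v) - F (a r)) \<bullet> b r"
  have m: "?h \<in> borel_measurable (S \<Otimes>\<^sub>M T)" by measurable
  have i: "integrable M (\<lambda>\<omega>. ?h (R \<omega>, V \<omega>))"
    using sq_int_inner[OF sq_int_noise assms(2)] by simp
  have "(\<integral>u. (G w u - F w) \<bullet> y \<partial>\<gamma>) = 0" for w y
  proof -
    have "(\<integral>u. (G w u - F w) \<bullet> y \<partial>\<gamma>) = (\<integral>u. G w u - F w \<partial>\<gamma>) \<bullet> y"
      using integrable_G by (intro integral_inner_left) simp
    also have "(\<integral>u. G w u - F w \<partial>\<gamma>) = 0"
      using integrable_G by (simp add: mean \<gamma>.prob_space)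
    finally show ?thesis by simp
  qed
  then have "(\<integral>v. ?h (R \<omega>, v) \<partial>distr M T V) = 0" for \<omega>
    using integral_distr_V[of "\<lambda>u. (G (a (R \<omega>)) u - F (a (R \<omega>))) \<bullet> b (R \<omega>)"] by simp
  then show ?thesis
    using M.expectation_indep(1)[OF indep m i] by simp
qed

end

subsection \<open>The stochastic extragradient method\<close>

text \<open>A pathwise inequality for arbitrary \<open>G1\<close> and \<open>G2\<close>. It is
  arranged so that each error occurs linearly only against a vector computable before its sample is
  drawn; these two terms will have mean zero.\<close>

lemma extragradient_step:
  fixes F :: "'a::real_inner \<Rightarrow> 'a" and z z' G1 G2 zs :: 'a
  assumes lip: "\<And>x y. norm (F x - F y) \<le> L * norm (x - y)"
    and minty: "F zh \<bullet> (zh - zs) + r * (norm (F zh))\<^sup>2 \<ge> 0"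
    and h: "0 \<le> h1" "0 \<le> h2" "0 \<le> L" "L * h1 \<le> 1"
    and zh: "zh = z - h1 *\<^sub>R G1" and z': "z' = z - h2 *\<^sub>R G2"
  shows "(norm (z' - zs))\<^sup>2 \<le> (norm (z - zs))\<^sup>2 - (h1 * h2 - h2\<^sup>2 - 2 * h2 * r) * (norm (F zh))\<^sup>2
    + 3 * h1 * h2 * (norm (G1 - F z))\<^sup>2 + h2\<^sup>2 * (norm (G2 - F zh))\<^sup>2
    + (G2 - F zh) \<bullet> ((2 * h2\<^sup>2) *\<^sub>R F zh - (2 * h2) *\<^sub>R (z - zs))
    + (G1 - F z) \<bullet> ((2 * h1 * h2) *\<^sub>R (F z - F (z - h1 *\<^sub>R F z)))"
proof -
  define a where "a = F zh"
  define g where "g = F z"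
  define q where "q = F (z - h1 *\<^sub>R g)"
  define y where "y = z - zs"
  \<comment> \<open>Since \<open>L * h1 \<le> 1\<close>, displacing the argument by
    \<open>h1 *\<^sub>R v\<close> moves \<open>F\<close> by at most \<open>norm v\<close>.\<close>
  have contract: "norm (F x - F x') \<le> norm v" if "x - x' = h1 *\<^sub>R v" for x x' v
  proof -
    have "norm (F x - F x') \<le> (L * h1) * norm v" using lip[of x x'] that h by (simp add: mult.assoc)
    also have "\<dots> \<le> norm v" using h by (simp add: mult_left_le_one_le)
    finally show ?thesis .
  qed
  have "zh - zs = y - h1 *\<^sub>R G1" by (simp add: zh y_def)
  then have m: "2 * h2 * (a \<bullet> y - h1 * (a \<bullet> G1) + r * (a \<bullet> a)) \<ge> 0"
    using minty h by (simp add: a_def inner_diff_right power2_norm_eq_inner)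
  have "norm (a - g) \<le> norm (- G1)"
    unfolding a_def g_def by (rule contract) (simp add: zh)
  then have "(a - g) \<bullet> (a - g) \<le> G1 \<bullet> G1"
    by (simp add: norm_le)
  then have l1: "h1 * h2 * (a \<bullet> a - 2 * (a \<bullet> g) + g \<bullet> g) \<le> h1 * h2 * (G1 \<bullet> G1)"
    using h by (intro mult_left_mono) (auto simp: inner_diff inner_commute)
  \<comment> \<open>The points \<open>zh\<close> and \<open>z - h1 *\<^sub>R g\<close> differ by
    \<open>h1\<close> times the noise, so swapping \<open>a\<close> for the noiseless
    \<open>q\<close> costs one noise norm. Pairing with the noise makes this quadratic.\<close>
  have "norm (a - q) \<le> norm (- (G1 - g))"
    unfolding a_def q_def g_def by (rule contract) (simp add: zh algebra_simps)
  then have "norm (a - q) * norm (G1 - g) \<le> (norm (G1 - g))\<^sup>2"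
    unfolding power2_eq_square by (intro mult_right_mono) (simp_all add: norm_minus_commute)
  then have "- ((a - q) \<bullet> (G1 - g)) \<le> (G1 - g) \<bullet> (G1 - g)"
    using Cauchy_Schwarz_ineq2[of "a - q" "G1 - g"] unfolding power2_norm_eq_inner by linarith
  then have l2: "2 * h1 * h2 * (- ((a - q) \<bullet> (G1 - g))) \<le> 2 * h1 * h2 * ((G1 - g) \<bullet> (G1 - g))"
    using h by (intro mult_left_mono) auto
  have eq: "z' - zs = y - h2 *\<^sub>R G2" by (simp add: z' y_def)
  \<comment> \<open>The rest is linear in the inner products. Of the coefficient 3 of the first
    noise, 1 comes from expanding \<open>G1 \<bullet> G1\<close> in \<open>l1\<close> and 2 from
    \<open>l2\<close>.\<close>
  show ?thesis
    unfolding a_def[symmetric] g_def[symmetric] q_def[symmetric] y_def[symmetric] power2_norm_eq_inner eq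
    using m l1 l2
    by (simp add: inner_diff inner_commute algebra_simps power2_eq_square)
qed

section \<open>Adapted processes driven by independent samples\<close>

locale independent_samples = stochastic_oracle \<gamma> G F g s + prob_space M
  for \<gamma> :: "'a::euclidean_space measure" and G F g s and M :: "'w measure" +
  fixes X :: "'i \<Rightarrow> 'w \<Rightarrow> 'a" and I :: "'i set"
  assumes indep: "indep_vars (\<lambda>_. borel) X I"
    and law: "i \<in> I \<Longrightarrow> distr M borel (X i) = \<gamma>"
begin

text \<open>Measurability with respect to the samples in \<open>J\<close>, in Doob-Dynkin form. The
  explicit \<open>\<phi>\<close> can serve as the map \<open>a\<close> of
  \<open>oracle_sample\<close>; equality is asked on \<open>space M\<close> because the iteration is
  specified only there.\<close>

definition adapted :: "'i set \<Rightarrow> ('w \<Rightarrow> 'b::topological_space) \<Rightarrow> bool"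
  where "adapted J Y \<longleftrightarrow> (\<exists>\<phi>. \<phi> \<in> borel_measurable (PiM J (\<lambda>_. borel)) \<and>
    (\<forall>\<omega>\<in>space M. Y \<omega> = \<phi> (\<lambda>i\<in>J. X i \<omega>)))"

lemma adapted_const: "adapted J (\<lambda>_. c)"
  unfolding adapted_def by (rule exI[of _ "\<lambda>_. c"]) simp

lemma adapted_sample: "i \<in> J \<Longrightarrow> adapted J (X i)"
  unfolding adapted_def by (rule exI[of _ "\<lambda>v. v i"]) auto

lemma adapted_cong: "(\<And>\<omega>. \<omega> \<in> space M \<Longrightarrow> Y \<omega> = Y' \<omega>) \<Longrightarrow> adapted J Y \<longleftrightarrow> adapted J Y'"
  by (simp add: adapted_def)

lemma adapted_mono:
  assumes "adapted J Y" "J \<subseteq> K"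
  shows "adapted K Y"
proof -
  obtain \<phi> where \<phi> [measurable]: "\<phi> \<in> borel_measurable (PiM J (\<lambda>_. borel))"
    and Y: "\<And>\<omega>. \<omega> \<in> space M \<Longrightarrow> Y \<omega> = \<phi> (\<lambda>i\<in>J. X i \<omega>)"
    using assms(1) by (auto simp: adapted_def)
  have "(\<lambda>v. restrict v J) \<in> measurable (PiM K (\<lambda>_. borel)) (PiM J (\<lambda>_. borel))"
    using assms(2) by (rule measurable_restrict_subset)
  then have "(\<lambda>v. \<phi> (restrict v J)) \<in> borel_measurable (PiM K (\<lambda>_. borel))"
    by (rule measurable_compose) simp
  moreover have "restrict (\<lambda>i\<in>K. X i \<omega>) J = (\<lambda>i\<in>J. X i \<omega>)" for \<omega>
    using assms(2) by (auto simp: restrict_def fun_eq_iff)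
  ultimately show ?thesis
    unfolding adapted_def using Y by (intro exI[of _ "\<lambda>v. \<phi> (restrict v J)"]) simp
qed

lemma adapted_compose2:
  fixes Y :: "'w \<Rightarrow> 'a" and Y' :: "'w \<Rightarrow> 'a" and k :: "'a \<Rightarrow> 'a \<Rightarrow> 'a"
  assumes "adapted J Y" "adapted J Y'" and "case_prod k \<in> borel_measurable (borel \<Otimes>\<^sub>M borel)"
  shows "adapted J (\<lambda>\<omega>. k (Y \<omega>) (Y' \<omega>))"
proof -
  obtain \<phi> \<phi>' where m: "\<phi> \<in> borel_measurable (PiM J (\<lambda>_. borel))" "\<phi>' \<in> borel_measurable (PiM J (\<lambda>_. borel))"
    and Y: "\<And>\<omega>. \<omega> \<in> space M \<Longrightarrow> Y \<omega> = \<phi> (\<lambda>i\<in>J. X i \<omega>)" "\<And>\<omega>. \<omega> \<in> space M \<Longrightarrow> Y' \<omega> = \<phi>' (\<lambda>i\<in>J. X i \<omega>)"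
    using assms(1,2) by (auto simp: adapted_def)
  have "(\<lambda>v. k (\<phi> v) (\<phi>' v)) \<in> borel_measurable (PiM J (\<lambda>_. borel))"
    using measurable_compose[OF measurable_Pair[OF m] assms(3)] by simp
  then show ?thesis
    unfolding adapted_def using Y by (intro exI[of _ "\<lambda>v. k (\<phi> v) (\<phi>' v)"]) simp
qed

lemma adapted_diff:
  "adapted J Y \<Longrightarrow> adapted J Y' \<Longrightarrow> adapted J (\<lambda>\<omega>. Y \<omega> - Y' \<omega> :: 'a)"
  by (rule adapted_compose2[where k = "(-)"]) measurable

lemma adapted_scaleR: "adapted J Y \<Longrightarrow> adapted J (\<lambda>\<omega>. c *\<^sub>R Y \<omega> :: 'a)"
  by (rule adapted_compose2[where k = "\<lambda>x y. c *\<^sub>R x"]) measurable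

lemma adapted_F: "adapted J Y \<Longrightarrow> adapted J (\<lambda>\<omega>. F (Y \<omega>))"
  by (rule adapted_compose2[where k = "\<lambda>x y. F x"]) measurable

lemma adapted_G: "adapted J Y \<Longrightarrow> i \<in> J \<Longrightarrow> adapted J (\<lambda>\<omega>. G (Y \<omega>) (X i \<omega>))"
  by (rule adapted_compose2[OF _ adapted_sample G_meas])

lemmas adapted_intros = adapted_const adapted_diff adapted_scaleR adapted_F

lemma oracle_noise:
  assumes "adapted J Y" and i: "i \<in> I" "i \<notin> J" "J \<subseteq> I"
  shows "sq_int M (\<lambda>\<omega>. G (Y \<omega>) (X i \<omega>))" (is ?sample)
    and "sq_int M (\<lambda>\<omega>. F (Y \<omega>))" (is ?F)
    and "expectation (\<lambda>\<omega>. (norm (G (Y \<omega>) (X i \<omega>) - F (Y \<omega>)))\<^sup>2) \<le> s" (is ?var)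
    and "adapted J Z \<Longrightarrow> sq_int M Z \<Longrightarrow>
      expectation (\<lambda>\<omega>. (G (Y \<omega>) (X i \<omega>) - F (Y \<omega>)) \<bullet> Z \<omega>) = 0"
proof -
  obtain \<phi> where \<phi>: "\<phi> \<in> borel_measurable (PiM J (\<lambda>_. borel))"
    and Y: "\<And>\<omega>. \<omega> \<in> space M \<Longrightarrow> Y \<omega> = \<phi> (\<lambda>i\<in>J. X i \<omega>)"
    using assms(1) by (auto simp: adapted_def)
  \<comment> \<open>Both variables in \<open>indep_var\<close> share one value type, so the fresh
    sample is packed as a family over the singleton \<open>{i}\<close> and recovered by evaluation
    at \<open>i\<close>.\<close>
  let ?R = "\<lambda>\<omega>. \<lambda>i\<in>J. X i \<omega>" and ?V = "\<lambda>\<omega>. \<lambda>j\<in>{i}. X j \<omega>"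
  interpret S: oracle_sample M \<gamma> G F g s "PiM J (\<lambda>_. borel)" "PiM {i} (\<lambda>_. borel)" ?R ?V "\<lambda>v. v i" \<phi>
  proof unfold_locales
    show "indep_var (PiM J (\<lambda>_. borel)) ?R (PiM {i} (\<lambda>_. borel)) ?V"
      using indep i by (intro indep_var_restrict) auto
    show "distr M borel (\<lambda>\<omega>. ?V \<omega> i) = \<gamma>" using law[OF i(1)] by simp
  qed (use \<phi> in auto)
  show ?sample using S.sq_int_sample by (simp add: Y cong: sq_int_cong)
  show ?F using S.sq_int_F by (simp add: Y cong: sq_int_cong)
  show ?var using S.expectation_noise_square by (simp add: Y cong: Bochner_Integration.integral_cong)
  assume "adapted J Z" "sq_int M Z"
  then obtain \<psi> where \<psi>: "\<psi> \<in> borel_measurable (PiM J (\<lambda>_. borel))"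
    and Z: "\<And>\<omega>. \<omega> \<in> space M \<Longrightarrow> Z \<omega> = \<psi> (\<lambda>i\<in>J. X i \<omega>)"
    by (auto simp: adapted_def)
  have "sq_int M (\<lambda>\<omega>. \<psi> (?R \<omega>))" using \<open>sq_int M Z\<close> by (simp add: Z cong: sq_int_cong)
  then show "expectation (\<lambda>\<omega>. (G (Y \<omega>) (X i \<omega>) - F (Y \<omega>)) \<bullet> Z \<omega>) = 0"
    using S.expectation_noise_inner[OF \<psi>] by (simp add: Y Z cong: Bochner_Integration.integral_cong)
qed

end

text \<open>In expectation the linear error terms of \<open>extragradient_step\<close> vanish, both
  variances are at most \<open>s\<close>, and the distances to \<open>zs\<close> telescope.\<close>

theorem (in stochastic_oracle) stochastic_extragradient:
  fixes M :: "'w measure" and uh u z zh :: "nat \<Rightarrow> 'w \<Rightarrow> 'a" and N :: nat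
  assumes "prob_space M"
    and indep: "prob_space.indep_vars M (\<lambda>_. borel) (case_sum uh u) ({..N} <+> {..N})"
    and law: "\<And>k. k \<le> N \<Longrightarrow> distr M borel (uh k) = \<gamma>" "\<And>k. k \<le> N \<Longrightarrow> distr M borel (u k) = \<gamma>"
    and z0: "\<And>\<omega>. \<omega> \<in> space M \<Longrightarrow> z 0 \<omega> = z0"
    and zh: "\<And>k \<omega>. k \<le> N \<Longrightarrow> \<omega> \<in> space M \<Longrightarrow> zh k \<omega> = z k \<omega> - h1 *\<^sub>R G (z k \<omega>) (uh k \<omega>)"
    and zSuc: "\<And>k \<omega>. k \<le> N \<Longrightarrow> \<omega> \<in> space M \<Longrightarrow> z (Suc k) \<omega> = z k \<omega> - h2 *\<^sub>R G (zh k \<omega>) (u k \<omega>)"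
    and lip: "\<And>x y. norm (F x - F y) \<le> L * norm (x - y)"
    and minty: "\<And>w. F w \<bullet> (w - zs) + r * (norm (F w))\<^sup>2 \<ge> 0"
    and h: "0 \<le> h1" "0 \<le> h2" "0 \<le> L" "L * h1 \<le> 1"
  shows "(h1 * h2 - h2\<^sup>2 - 2 * h2 * r) *
      (\<Sum>k\<le>N. prob_space.expectation M (\<lambda>\<omega>. (norm (F (zh k \<omega>)))\<^sup>2))
    \<le> (norm (z0 - zs))\<^sup>2 + (real N + 1) * ((3 * h1 * h2 + h2\<^sup>2) * s)"
proof -
  interpret prob_space M by fact
  interpret independent_samples \<gamma> G F g s M "case_sum uh u" "{..N} <+> {..N}"
    using indep law by unfold_locales (auto split: sum.splits)
  \<comment> \<open>The filtration: \<open>J k\<close> holds the samples used by \<open>z k\<close>.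
    Adding \<open>Inl k\<close>, the index of \<open>uh k\<close>, gives those used by
    \<open>zh k\<close>, and adding \<open>Inr k\<close>, the index of \<open>u k\<close>, stays
    within \<open>J (Suc k)\<close>.\<close>
  define J where "J k = {..<k} <+> {..<k}" for k :: nat
  have J: "J k \<subseteq> {..N} <+> {..N}" "insert (Inl k) (J k) \<subseteq> {..N} <+> {..N}"
    "Inl k \<notin> J k" "Inr k \<notin> insert (Inl k) (J k)" "Inl k \<in> {..N} <+> {..N}" "Inr k \<in> {..N} <+> {..N}"
    "insert (Inr k) (insert (Inl k) (J k)) \<subseteq> J (Suc k)"
    if "k \<le> N" for k
    using that by (auto simp: J_def)
  have half: "adapted (insert (Inl k) (J k)) (zh k)" if "k \<le> N" "adapted (J k) (z k)" for k
  proof -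
    have "adapted (insert (Inl k) (J k)) (\<lambda>\<omega>. z k \<omega> - h1 *\<^sub>R G (z k \<omega>) (case_sum uh u (Inl k) \<omega>))"
      by (intro adapted_diff adapted_scaleR adapted_G adapted_mono[OF that(2)]) auto
    then show ?thesis using zh that(1) by (simp cong: adapted_cong)
  qed
  \<comment> \<open>The range goes to \<open>Suc N\<close> because the last step involves the
    expected distance of \<open>z (Suc N)\<close>.\<close>
  have z: "adapted (J k) (z k) \<and> sq_int M (z k)" if "k \<le> Suc N" for k
    using that
  proof (induction k)
    case 0
    then show ?case using z0 by (simp cong: adapted_cong sq_int_cong add: adapted_const sq_int_const)
  next
    case (Suc k)
    then have k: "k \<le> N" and IH: "adapted (J k) (z k)" "sq_int M (z k)" by auto
    let ?J = "insert (Inr k) (insert (Inl k) (J k))"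
    have "adapted ?J (\<lambda>\<omega>. G (zh k \<omega>) (case_sum uh u (Inr k) \<omega>))"
      by (intro adapted_G adapted_mono[OF half[OF k IH(1)]]) auto
    then have "adapted ?J (\<lambda>\<omega>. z k \<omega> - h2 *\<^sub>R G (zh k \<omega>) (case_sum uh u (Inr k) \<omega>))"
      by (intro adapted_diff adapted_scaleR adapted_mono[OF IH(1)]) auto
    then have "adapted (J (Suc k)) (\<lambda>\<omega>. z k \<omega> - h2 *\<^sub>R G (zh k \<omega>) (case_sum uh u (Inr k) \<omega>))"
      by (rule adapted_mono) (rule J(7)[OF k])
    moreover have "sq_int M (\<lambda>\<omega>. z k \<omega> - h2 *\<^sub>R G (zh k \<omega>) (case_sum uh u (Inr k) \<omega>))"
      using J[OF k] half[OF k IH(1)] by (intro sq_int_diff sq_int_scaleR IH(2) oracle_noise(1))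
    ultimately show ?case using zSuc[OF k] by (simp cong: adapted_cong sq_int_cong)
  qed
  let ?d = "\<lambda>k. expectation (\<lambda>\<omega>. (norm (z k \<omega> - zs))\<^sup>2)"
  let ?a = "\<lambda>k. expectation (\<lambda>\<omega>. (norm (F (zh k \<omega>)))\<^sup>2)"
  let ?c = "h1 * h2 - h2\<^sup>2 - 2 * h2 * r"
  have step: "?d (Suc k) \<le> ?d k - ?c * ?a k + (3 * h1 * h2 + h2\<^sup>2) * s" if k: "k \<le> N" for k
  proof -
    have zk: "adapted (J k) (z k)" "sq_int M (z k)" "sq_int M (z (Suc k))" using z k by auto
    have zhk: "adapted (insert (Inl k) (J k)) (zh k)" using half[OF k zk(1)] .
    define \<xi>1 where "\<xi>1 \<omega> = G (z k \<omega>) (uh k \<omega>) - F (z k \<omega>)" for \<omega>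
    define \<xi>2 where "\<xi>2 \<omega> = G (zh k \<omega>) (u k \<omega>) - F (zh k \<omega>)" for \<omega>
    \<comment> \<open>\<open>S1\<close> depends on \<open>z k\<close> alone and \<open>S2\<close> on
      \<open>z k\<close> and \<open>zh k\<close>, so each is determined before the sample in its
      partner \<open>\<xi>1\<close> or \<open>\<xi>2\<close> is drawn.\<close>
    define S2 where "S2 \<omega> = (2 * h2\<^sup>2) *\<^sub>R F (zh k \<omega>) - (2 * h2) *\<^sub>R (z k \<omega> - zs)" for \<omega>
    define S1 where "S1 \<omega> = (2 * h1 * h2) *\<^sub>R (F (z k \<omega>) - F (z k \<omega> - h1 *\<^sub>R F (z k \<omega>)))" for \<omega>
    note n1 = oracle_noise[OF zk(1) J(5)[OF k] J(3)[OF k] J(1)[OF k], simplified]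
    note n2 = oracle_noise[OF zhk J(6)[OF k] J(4)[OF k] J(2)[OF k], simplified]
    have "adapted (J k) (\<lambda>\<omega>. z k \<omega> - h1 *\<^sub>R F (z k \<omega>))"
      by (intro adapted_intros zk)
    note Fp = oracle_noise(2)[OF this J(5)[OF k] J(3)[OF k] J(1)[OF k]]
    have sq: "sq_int M \<xi>1" "sq_int M \<xi>2" "sq_int M S1" "sq_int M S2" "sq_int M (\<lambda>\<omega>. F (zh k \<omega>))"
      "sq_int M (\<lambda>\<omega>. z k \<omega> - zs)" "sq_int M (\<lambda>\<omega>. z (Suc k) \<omega> - zs)"
      unfolding \<xi>1_def \<xi>2_def S1_def S2_def
      by (intro sq_int_diff sq_int_scaleR n1 n2 Fp zk sq_int_const)+
    have "adapted (J k) S1"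
      unfolding S1_def by (intro adapted_intros zk)
    then have E1: "expectation (\<lambda>\<omega>. \<xi>1 \<omega> \<bullet> S1 \<omega>) = 0"
      unfolding \<xi>1_def by (rule n1(4)) (rule sq)
    have "adapted (insert (Inl k) (J k)) S2"
      unfolding S2_def by (intro adapted_intros zhk adapted_mono[OF zk(1)]) auto
    then have E2: "expectation (\<lambda>\<omega>. \<xi>2 \<omega> \<bullet> S2 \<omega>) = 0"
      unfolding \<xi>2_def by (rule n2(4)) (rule sq)
    note int = sq(1,2,5,6)[THEN sq_intD(2)] sq_int_inner[OF sq(1,3)] sq_int_inner[OF sq(2,4)]
    have "?d (Suc k) \<le> expectation (\<lambda>\<omega>. (norm (z k \<omega> - zs))\<^sup>2 - ?c * (norm (F (zh k \<omega>)))\<^sup>2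
        + 3 * h1 * h2 * (norm (\<xi>1 \<omega>))\<^sup>2 + h2\<^sup>2 * (norm (\<xi>2 \<omega>))\<^sup>2 + \<xi>2 \<omega> \<bullet> S2 \<omega> + \<xi>1 \<omega> \<bullet> S1 \<omega>)"
    proof (rule integral_mono)
      fix \<omega> assume w: "\<omega> \<in> space M"
      show "(norm (z (Suc k) \<omega> - zs))\<^sup>2 \<le> (norm (z k \<omega> - zs))\<^sup>2 - ?c * (norm (F (zh k \<omega>)))\<^sup>2
        + 3 * h1 * h2 * (norm (\<xi>1 \<omega>))\<^sup>2 + h2\<^sup>2 * (norm (\<xi>2 \<omega>))\<^sup>2 + \<xi>2 \<omega> \<bullet> S2 \<omega> + \<xi>1 \<omega> \<bullet> S1 \<omega>"
        unfolding \<xi>1_def \<xi>2_def S1_def S2_def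
        by (rule extragradient_step[OF lip minty h zh[OF k w] zSuc[OF k w]])
    qed (use int sq(7)[THEN sq_intD(2)] in auto)
    also have "\<dots> = ?d k - ?c * ?a k + 3 * h1 * h2 * expectation (\<lambda>\<omega>. (norm (\<xi>1 \<omega>))\<^sup>2)
        + h2\<^sup>2 * expectation (\<lambda>\<omega>. (norm (\<xi>2 \<omega>))\<^sup>2)"
      using int by (simp add: E1 E2)
    also have "\<dots> \<le> ?d k - ?c * ?a k + 3 * h1 * h2 * s + h2\<^sup>2 * s"
      using n1(3) n2(3) h unfolding \<xi>1_def \<xi>2_def by (intro add_mono mult_left_mono) auto
    finally show ?thesis by (simp add: algebra_simps)
  qed
  have "?c * (\<Sum>k<n. ?a k) \<le> (norm (z0 - zs))\<^sup>2 - ?d n + real n * ((3 * h1 * h2 + h2\<^sup>2) * s)"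
    if "n \<le> Suc N" for n
    using that
  proof (induction n)
    case 0
    then show ?case using z0 by (simp add: prob_space cong: Bochner_Integration.integral_cong)
  next
    case (Suc n)
    then have "?c * (\<Sum>k<n. ?a k) \<le> (norm (z0 - zs))\<^sup>2 - ?d n + real n * ((3 * h1 * h2 + h2\<^sup>2) * s)"
      by simp
    with step[of n] Suc.prems show ?case
      by (simp add: distrib_left distrib_right)
  qed
  from this[of "Suc N"] have "?c * (\<Sum>k<Suc N. ?a k) \<le> (norm (z0 - zs))\<^sup>2 - ?d (Suc N)
      + (real N + 1) * ((3 * h1 * h2 + h2\<^sup>2) * s)"
    by (simp add: add.commute)
  moreover have "?d (Suc N) \<ge> 0" by simp
  ultimately show ?thesis unfolding lessThan_Suc_atMost by linarith
qed

subsection \<open>The zeroth-order extragradient method\<close>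

text \<open>
  The factor \<open>2\<close> in the first summand and the constant \<open>3\<close> in the second are not sharp: the step
  size conditions make the coefficient of \<open>S\<close> at least \<open>(P * h2\<^sup>2 - \<rho>) / P\<close>, twice what is needed.
\<close>

lemma bound_of_weighted_sum:
  fixes h1 h2 \<rho> lmin lmax \<kappa> L1 n S D \<sigma> :: real
  defines "P \<equiv> L1 * lmax * lmin * \<kappa>"
  assumes pos: "0 < lmin" "0 < lmax" "0 < \<kappa>" "0 < L1" "0 < h1" "0 < h2" "0 < n" and nn: "0 \<le> S" "0 \<le> D" "0 \<le> \<rho>"
    and h1: "h1 \<le> 1 / (L1 * lmax * \<kappa>)" and h2: "sqrt (\<rho> / P) < h2" "h2 \<le> h1 / 2"
    and main: "(h1 * h2 - h2\<^sup>2 - 2 * h2 * (\<rho> / (2 * lmin))) * S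
      \<le> D + n * ((3 * h1 * h2 + h2\<^sup>2) * (lmax * \<sigma>\<^sup>2))"
  shows "1 / n * S \<le> 2 * P * D / ((P * h2\<^sup>2 - \<rho>) * n) + 3 * lmin / (L1 * \<kappa> * (P * h2\<^sup>2 - \<rho>)) * \<sigma>\<^sup>2"
proof -
  have P: "P > 0" using pos by (simp add: P_def)
  define Q where "Q = P * h2\<^sup>2 - \<rho>"
  have "\<rho> / P < h2\<^sup>2" using power_strict_mono[OF h2(1), of 2] P nn by simp
  then have Q: "Q > 0" using P by (simp add: Q_def field_simps)
  have h1': "L1 * lmax * \<kappa> * h1 \<le> 1" using h1 pos by (simp add: field_simps)
  \<comment> \<open>The upper bound on \<open>h1\<close> turns the weak Minty loss
    \<open>h2 * \<rho> / lmin\<close> into at most \<open>\<rho> / P\<close>, matching the threshold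
    in the lower bound on \<open>h2\<close>.\<close>
  have "P * h2 \<le> lmin * (L1 * lmax * \<kappa> * h1)"
    using mult_left_mono[of h2 h1 P] h2(2) pos P by (simp add: P_def mult_ac)
  also have "\<dots> \<le> lmin * 1" using h1' pos by (intro mult_left_mono) auto
  finally have "P * h2 * \<rho> \<le> lmin * \<rho>" using nn by (intro mult_right_mono) auto
  then have a: "h2 * \<rho> / lmin \<le> \<rho> / P" using P pos by (simp add: field_simps)
  have "h2 * (2 * h2) \<le> h2 * h1" using h2(2) pos by (intro mult_left_mono) auto
  then have b: "2 * h2\<^sup>2 \<le> h1 * h2" by (simp add: power2_eq_square mult_ac)
  have "Q / P \<le> h1 * h2 - h2\<^sup>2 - 2 * h2 * (\<rho> / (2 * lmin))"
    using a b P by (simp add: Q_def diff_divide_distrib)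
  then have c: "Q / P * S \<le> D + n * ((3 * h1 * h2 + h2\<^sup>2) * (lmax * \<sigma>\<^sup>2))"
    using main mult_right_mono[OF _ nn(1)] order_trans by blast
  have "h2 * h2 \<le> (h1 / 2) * (h1 / 2)" "h1 * h2 \<le> h1 * (h1 / 2)"
    using h2(2) pos by (intro mult_mono; simp)+
  then have "3 * h1 * h2 + h2\<^sup>2 \<le> 3 * h1\<^sup>2"
    using zero_le_square[of h1] unfolding power2_eq_square by linarith
  then have "P * ((3 * h1 * h2 + h2\<^sup>2) * (lmax * \<sigma>\<^sup>2)) \<le> P * ((3 * h1\<^sup>2) * (lmax * \<sigma>\<^sup>2))"
    using P pos by (intro mult_left_mono mult_right_mono) auto
  \<comment> \<open>\<open>P * lmax\<close> is rewritten to expose the square of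
    \<open>L1 * lmax * \<kappa> * h1\<close>, which the step size condition bounds by 1.\<close>
  also have "\<dots> = (L1 * lmax * \<kappa> * h1)\<^sup>2 * (3 * lmin * \<sigma>\<^sup>2 / (L1 * \<kappa>))"
    using pos by (simp add: P_def power2_eq_square field_simps)
  also have "\<dots> \<le> 1 * (3 * lmin * \<sigma>\<^sup>2 / (L1 * \<kappa>))"
    using h1' pos by (intro mult_right_mono power_le_one) auto
  finally have d: "P * ((3 * h1 * h2 + h2\<^sup>2) * (lmax * \<sigma>\<^sup>2)) \<le> 3 * lmin * \<sigma>\<^sup>2 / (L1 * \<kappa>)" by simp
  have "Q * S \<le> P * (D + n * ((3 * h1 * h2 + h2\<^sup>2) * (lmax * \<sigma>\<^sup>2)))"
    using c P by (simp add: field_simps)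
  also have "\<dots> = P * D + n * (P * ((3 * h1 * h2 + h2\<^sup>2) * (lmax * \<sigma>\<^sup>2)))" by (simp add: algebra_simps)
  also have "\<dots> \<le> 2 * P * D + n * (3 * lmin * \<sigma>\<^sup>2 / (L1 * \<kappa>))"
    using d P pos nn by (intro add_mono mult_left_mono) auto
  finally have "S \<le> (2 * P * D + n * (3 * lmin * \<sigma>\<^sup>2 / (L1 * \<kappa>))) / Q"
    using Q by (simp add: pos_le_divide_eq mult.commute)
  then have "S / n \<le> (2 * P * D + n * (3 * lmin * \<sigma>\<^sup>2 / (L1 * \<kappa>))) / Q / n"
    using pos by (intro divide_right_mono) auto
  also have "\<dots> = 2 * P * D / (Q * n) + 3 * lmin / (L1 * \<kappa> * Q) * \<sigma>\<^sup>2"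
  proof -
    have "(a + n * e) / Q / n = a / (Q * n) + e / Q" for a e
      using pos(7) Q by (simp add: field_simps)
    from this[of "2 * P * D" "3 * lmin * \<sigma>\<^sup>2 / (L1 * \<kappa>)"] show ?thesis
      by (simp only:) simp
  qed
  finally show ?thesis by (simp add: Q_def)
qed

section \<open>The saddle operator and the random oracle\<close>

lemma GDERIV_imp_grad_eq:
  assumes "GDERIV f z :> D"
  shows "grad f z = D"
  unfolding grad_def
proof (rule the_equality)
  fix E assume "GDERIV f z :> E"
  then have "(\<lambda>h. h \<bullet> E) = (\<lambda>h. h \<bullet> D)"
    using assms has_derivative_unique unfolding gderiv_def by blast
  then have "(E - D) \<bullet> (E - D) = 0"
    by (metis inner_diff_right right_minus_eq)
  then show "E = D" by simp
qed (rule assms)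

text \<open>Isolates the sign change of the saddle operator as a linear isometry: it commutes with
  integrals and disappears under the Euclidean norm.\<close>

definition flip_snd :: "'a::uminus \<times> 'b::uminus \<Rightarrow> 'a \<times> 'b"
  where "flip_snd v = (fst v, - snd v)"

lemma bounded_linear_flip_snd: "bounded_linear (flip_snd :: 'a::real_normed_vector \<times> 'b::real_normed_vector \<Rightarrow> _)"
  unfolding flip_snd_def
  by (rule bounded_linear_Pair[OF bounded_linear_fst bounded_linear_minus[OF bounded_linear_snd]])

lemma norm_flip_snd: "norm (flip_snd v) = norm v"
  by (cases v) (simp add: flip_snd_def norm_Pair)

text \<open>The chain rule along the slices through \<open>z\<close> identifies the partial
  gradients with the components of \<open>D\<close>.\<close>

lemma GDERIV_imp_saddle_op_eq:
  assumes "GDERIV g z :> D"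
  shows "saddle_op g z = flip_snd D"
proof -
  have d: "(g has_derivative (\<lambda>h. h \<bullet> D)) (at (fst z, snd z))"
    using assms by (simp add: gderiv_def)
  have "((\<lambda>x. g (x, snd z)) has_derivative (\<lambda>h. (h, 0) \<bullet> D)) (at (fst z))"
    by (rule has_derivative_compose[where f = "\<lambda>x. (x, snd z)" and f' = "\<lambda>h. (h, 0)", OF _ d]) (auto intro!: derivative_eq_intros)
  then have "grad (\<lambda>x. g (x, snd z)) (fst z) = fst D"
    by (intro GDERIV_imp_grad_eq) (simp add: gderiv_def inner_prod_def)
  moreover have "((\<lambda>y. g (fst z, y)) has_derivative (\<lambda>h. (0, h) \<bullet> D)) (at (snd z))"
    by (rule has_derivative_compose[where f = "\<lambda>y. (fst z, y)" and f' = "\<lambda>h. (0, h)", OF _ d]) (auto intro!: derivative_eq_intros)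
  then have "grad (\<lambda>y. g (fst z, y)) (snd z) = snd D"
    by (intro GDERIV_imp_grad_eq) (simp add: gderiv_def inner_prod_def)
  ultimately show ?thesis by (simp add: saddle_op_def flip_snd_def)
qed

lemma zo_oracle_eq:
  "zo_oracle B1 B2 \<mu> f z u = flip_snd (((f (z + \<mu> *\<^sub>R u) - f z) / \<mu>) *\<^sub>R block_diag B1 B2 u)"
  by (simp add: zo_oracle_def flip_snd_def block_diag_def)

text \<open>The mean is the integral formula of \<open>GDERIV_smoothing\<close> with
  \<open>flip_snd\<close> pulled out. In the envelope one factor \<open>norm u\<close> comes from
  the Lipschitz bound on \<open>f\<close> and one from \<open>B u\<close>; passing from the dual to
  the Euclidean norm multiplies the variance by the largest eigenvalue.\<close>

lemma zo_oracle_stochastic_oracle: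
  fixes B1 :: "real^'n^'n" and B2 :: "real^'m^'m"
    and f :: "(real^'n) \<times> (real^'m) \<Rightarrow> real"
  defines "B \<equiv> block_diag B1 B2"
  assumes spd: "sym_pos_def B1" "sym_pos_def B2" and prob: "prob_space (gaussian B1 B2)"
    and C: "0 \<le> C" "\<And>x y. \<bar>f x - f y\<bar> \<le> C * norm (x - y)" and "0 < \<mu>"
    and F_meas: "saddle_op (smoothing B1 B2 \<mu> f) \<in> borel_measurable borel"
    and var: "\<And>w. (\<integral>v. (wnorm (inv B) (zo_oracle B1 B2 \<mu> f w v - saddle_op (smoothing B1 B2 \<mu> f) w))\<^sup>2
      \<partial>gaussian B1 B2) \<le> \<sigma>\<^sup>2"
  shows "stochastic_oracle (gaussian B1 B2) (zo_oracle B1 B2 \<mu> f) (saddle_op (smoothing B1 B2 \<mu> f))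
      (\<lambda>u. C * Max (eigenvalues B) * (norm u)\<^sup>2) (Max (eigenvalues B) * \<sigma>\<^sup>2)"
proof -
  define \<gamma> where "\<gamma> = gaussian B1 B2"
  define G where "G = zo_oracle B1 B2 \<mu> f"
  define F where "F = saddle_op (smoothing B1 B2 \<mu> f)"
  interpret pos_def B unfolding B_def using spd by (rule pos_def_block_diag)
  interpret gauss_measure B "sqrt (det B1 * det B2 / (2 * pi) ^ (CARD('n) + CARD('m)))" \<gamma>
  proof (intro gauss_measure.intro gauss_measure_axioms.intro pos_def_axioms)
    show "prob_space \<gamma>" using prob by (simp add: \<gamma>_def)
  qed (simp add: \<gamma>_def gaussian_def B_def)
  define l where "l = Max (eigenvalues B)"
  have l: "l > 0" using Min_eigenvalues_pos Min_le_Max by (simp add: l_def)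
  have "continuous_on UNIV f"
    using C by (intro lipschitz_on_continuous_on[OF lipschitz_onI, of _ _ C]) (auto simp: dist_norm)
  then have [measurable]: "f \<in> borel_measurable borel" by (rule borel_measurable_continuous_onI)
  have [measurable]: "flip_snd \<in> borel_measurable (borel :: ((real^'n) \<times> (real^'m)) measure)"
    by (intro borel_measurable_continuous_onI linear_continuous_on bounded_linear_flip_snd)
  have [measurable]: "F \<in> borel_measurable borel" using F_meas by (simp add: F_def)
  have bound: "norm (((f (w + \<mu> *\<^sub>R u) - f w) / \<mu>) *\<^sub>R B u) \<le> C * l * (norm u)\<^sup>2" for w u
  proof -
    have "\<bar>(f (w + \<mu> *\<^sub>R u) - f w) / \<mu>\<bar> \<le> C * norm u"
      using C(2)[of "w + \<mu> *\<^sub>R u" w] \<open>0 < \<mu>\<close> by (simp add: abs_divide divide_le_eq mult_ac)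
    then have "\<bar>(f (w + \<mu> *\<^sub>R u) - f w) / \<mu>\<bar> * norm (B u) \<le> (C * norm u) * (l * norm u)"
      using norm_A_le[of u] C(1) by (intro mult_mono) (auto simp: l_def)
    then show ?thesis by (simp add: power2_eq_square mult_ac)
  qed
  have Gb: "norm (G w u) \<le> C * l * (norm u)\<^sup>2" for w u
    unfolding G_def zo_oracle_eq norm_flip_snd B_def[symmetric] by (rule bound)
  have Gm: "case_prod G \<in> borel_measurable (borel \<Otimes>\<^sub>M borel)"
    unfolding G_def zo_oracle_eq B_def[symmetric] by measurable
  have Gw [measurable]: "G w \<in> borel_measurable borel" for w
    unfolding G_def zo_oracle_eq B_def[symmetric] by measurable
  have g2: "integrable \<gamma> (\<lambda>u. (C * l * (norm u)\<^sup>2)\<^sup>2)"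
    using integrable_norm_power[of 4] by (simp add: power_mult_distrib flip: power_mult)
  have mean: "(\<integral>u. G w u \<partial>\<gamma>) = F w" for w
  proof -
    have i: "integrable \<gamma> (\<lambda>u. ((f (w + \<mu> *\<^sub>R u) - f w) / \<mu>) *\<^sub>R B u)"
    proof (rule Bochner_Integration.integrable_bound)
      show "integrable \<gamma> (\<lambda>u. C * l * (norm u)\<^sup>2)"
        by (intro integrable_mult_right integrable_norm_power)
      show "AE u in \<gamma>. norm (((f (w + \<mu> *\<^sub>R u) - f w) / \<mu>) *\<^sub>R B u) \<le> norm (C * l * (norm u)\<^sup>2)"
        by (intro AE_I2 order_trans[OF bound]) simp
    qed measurable
    have "F w = flip_snd (\<integral>u. ((f (w + \<mu> *\<^sub>R u) - f w) / \<mu>) *\<^sub>R B u \<partial>\<gamma>)"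
      using GDERIV_smoothing[OF C(2,1) \<open>0 < \<mu>\<close>, of w]
      unfolding F_def by (intro GDERIV_imp_saddle_op_eq) (simp add: smoothing_def[abs_def] \<gamma>_def)
    also have "\<dots> = (\<integral>u. G w u \<partial>\<gamma>)"
      unfolding G_def zo_oracle_eq B_def[symmetric]
      by (rule integral_bounded_linear[OF bounded_linear_flip_snd i, symmetric])
    finally show ?thesis by simp
  qed
  have "(\<integral>u. (norm (G w u - F w))\<^sup>2 \<partial>\<gamma>) \<le> l * \<sigma>\<^sup>2" for w
  proof -
    have "sq_int \<gamma> (\<lambda>u. C * l * (norm u)\<^sup>2)" using g2 by (simp add: sq_int_def)
    then have "sq_int \<gamma> (\<lambda>u. G w u)"
      by (rule sq_int_bound) (auto intro: order_trans[OF Gb abs_ge_self])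
    then have int: "integrable \<gamma> (\<lambda>u. (norm (G w u - F w))\<^sup>2)"
      by (intro sq_intD(2) sq_int_diff G.sq_int_const)
    have [measurable]: "inv B \<in> borel_measurable borel"
      by (intro borel_measurable_continuous_onI linear_continuous_on
          linear_conv_bounded_linear[THEN iffD1] linear_inv)
    \<comment> \<open>A non-integrable function has integral 0, so the bound on the dual variance
      carries information only once integrability is known.\<close>
    have int': "integrable \<gamma> (\<lambda>u. (wnorm (inv B) (G w u - F w))\<^sup>2)"
    proof (rule Bochner_Integration.integrable_bound)
      show "integrable \<gamma> (\<lambda>u. (norm (G w u - F w))\<^sup>2 / Min (eigenvalues B))" using int by simp
      show "(\<lambda>u. (wnorm (inv B) (G w u - F w))\<^sup>2) \<in> borel_measurable \<gamma>"
        unfolding wnorm_def by measurable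
      show "AE u in \<gamma>. norm ((wnorm (inv B) (G w u - F w))\<^sup>2)
          \<le> norm ((norm (G w u - F w))\<^sup>2 / Min (eigenvalues B))"
        using dual_le_norm Min_eigenvalues_pos by (intro AE_I2) simp
    qed
    have "(\<integral>u. (norm (G w u - F w))\<^sup>2 \<partial>\<gamma>) \<le> (\<integral>u. l * (wnorm (inv B) (G w u - F w))\<^sup>2 \<partial>\<gamma>)"
      using int int' norm_le_dual by (intro integral_mono) (auto simp: l_def)
    also have "\<dots> \<le> l * \<sigma>\<^sup>2"
      using var[of w] l by (simp add: \<gamma>_def G_def F_def)
    finally show ?thesis .
  qed
  then have "stochastic_oracle \<gamma> G F (\<lambda>u. C * l * (norm u)\<^sup>2) (l * \<sigma>\<^sup>2)"
    by (intro stochastic_oracle.intro G.prob_space_axioms Gb Gm g2 mean) (assumption | simp)+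
  then show ?thesis by (simp add: \<gamma>_def G_def F_def l_def)
qed

theorem theorem5:
  fixes B1 :: "real^'n^'n" and B2 :: "real^'m^'m"
    and B :: "(real^'n) \<times> (real^'m) \<Rightarrow> (real^'n) \<times> (real^'m)"
    and f f\<mu> :: "(real^'n) \<times> (real^'m) \<Rightarrow> real"
    and F :: "(real^'n) \<times> (real^'m) \<Rightarrow> (real^'n) \<times> (real^'m)"
    and G :: "(real^'n) \<times> (real^'m) \<Rightarrow> (real^'n) \<times> (real^'m) \<Rightarrow> (real^'n) \<times> (real^'m)"
    and lmin lmax \<kappa> L0 L1 \<mu> \<sigma> \<rho> h1 h2 :: real
    and z0 zstar :: "(real^'n) \<times> (real^'m)"
    and M :: "'w measure"
    and uhat u zhat z :: "nat \<Rightarrow> 'w \<Rightarrow> (real^'n) \<times> (real^'m)"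
    and N :: nat
  assumes "sym_pos_def B1" and "sym_pos_def B2"
    and "B = block_diag B1 B2"
    and "lmin = Min (eigenvalues B)" and "lmax = Max (eigenvalues B)" and "\<kappa> = lmax / lmin"
    and "L0 > 0" and "\<And>z1 z2. \<bar>f z1 - f z2\<bar> \<le> L0 * wnorm B (z1 - z2)"
    and "\<mu> > 0"
    and "f\<mu> = smoothing B1 B2 \<mu> f" and "F = saddle_op f\<mu>" and "G = zo_oracle B1 B2 \<mu> f"
    and "L1 > 0"
    and "\<And>z1 z2. wnorm (inv B) (grad f\<mu> z1 - grad f\<mu> z2) \<le> L1 * wnorm B (z1 - z2)"
    and "\<sigma> \<ge> 0"
    and "\<And>w. (\<integral>v. (wnorm (inv B) (G w v - F w))\<^sup>2 \<partial>gaussian B1 B2) \<le> \<sigma>\<^sup>2"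
    and "0 \<le> \<rho>" and "\<rho> < 1 / (4 * L1 * \<kappa>\<^sup>2)"
    and "\<And>w. F w \<bullet> (w - zstar) + \<rho> / 2 * (wnorm (inv B) (F w))\<^sup>2 \<ge> 0"
    and "h1 > 0" and "h2 > 0"
    and "h1 \<le> 1 / (L1 * lmax * \<kappa>)"
    and "sqrt (\<rho> / (L1 * lmax * lmin * \<kappa>)) < h2" and "h2 \<le> h1 / 2"
    and "prob_space M"
    and "prob_space.indep_vars M (\<lambda>_. borel) (case_sum uhat u) ({..N} <+> {..N})"
    and "\<And>k. k \<le> N \<Longrightarrow> distr M borel (uhat k) = gaussian B1 B2"
    and "\<And>k. k \<le> N \<Longrightarrow> distr M borel (u k) = gaussian B1 B2"
    and "\<And>\<omega>. \<omega> \<in> space M \<Longrightarrow> z 0 \<omega> = z0"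
    and "\<And>k \<omega>. k \<le> N \<Longrightarrow> \<omega> \<in> space M \<Longrightarrow> zhat k \<omega> = z k \<omega> - h1 *\<^sub>R G (z k \<omega>) (uhat k \<omega>)"
    and "\<And>k \<omega>. k \<le> N \<Longrightarrow> \<omega> \<in> space M \<Longrightarrow> z (Suc k) \<omega> = z k \<omega> - h2 *\<^sub>R G (zhat k \<omega>) (u k \<omega>)"
  shows "1 / (real N + 1) * (\<Sum>k=0..N. prob_space.expectation M (\<lambda>\<omega>. (norm (F (zhat k \<omega>)))\<^sup>2))
    \<le> 2 * L1 * lmax * lmin * \<kappa> * (norm (z0 - zstar))\<^sup>2
        / ((L1 * lmax * lmin * \<kappa> * h2\<^sup>2 - \<rho>) * (real N + 1))
      + 3 * lmin / (L1 * \<kappa> * (L1 * lmax * lmin * \<kappa> * h2\<^sup>2 - \<rho>)) * \<sigma>\<^sup>2"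
proof -
  have B: "B = block_diag B1 B2" and lmin: "lmin = Min (eigenvalues B)"
    and lmax: "lmax = Max (eigenvalues B)" and \<kappa>: "\<kappa> = lmax / lmin"
    by (rule assms)+
  have lip: "\<And>z1 z2. \<bar>f z1 - f z2\<bar> \<le> L0 * wnorm B (z1 - z2)" by (rule assms(8))
  have grad_lip: "\<And>z1 z2. wnorm (inv B) (grad f\<mu> z1 - grad f\<mu> z2) \<le> L1 * wnorm B (z1 - z2)"
    by (rule assms(14))
  have minty: "\<And>w. F w \<bullet> (w - zstar) + \<rho> / 2 * (wnorm (inv B) (F w))\<^sup>2 \<ge> 0" by (rule assms(19))
  interpret prob_space M by (rule assms(25))
  interpret B: pos_def B unfolding B using assms(1,2) by (rule pos_def_block_diag)
  have l: "0 < lmin" "0 < lmax" "lmin \<le> lmax"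
    using B.Min_eigenvalues_pos B.Min_le_Max by (auto simp: lmin lmax)
  then have \<kappa>1: "\<kappa> \<ge> 1" by (simp add: \<kappa>)
  \<comment> \<open>The Gaussian measure is the law of \<open>uhat 0\<close>, hence a probability
    measure; this replaces computing its normalization.\<close>
  have meas: "uhat 0 \<in> borel_measurable M"
    using assms(26) unfolding indep_vars_def by force
  have prob: "prob_space (gaussian B1 B2)"
    using prob_space_distr[OF meas] assms(27)[of 0] by simp
  have wn: "wnorm B v \<le> sqrt lmax * norm v" for v
  proof -
    have "(wnorm B v)\<^sup>2 \<le> (sqrt lmax * norm v)\<^sup>2"
      using B.wnorm_le[of v] l by (simp add: lmax power_mult_distrib)
    then show ?thesis by (rule power2_le_imp_le) (use l in auto)
  qed
  define C where "C = L0 * sqrt lmax"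
  have C: "0 \<le> C" "\<bar>f x - f y\<bar> \<le> C * norm (x - y)" for x y
    using order_trans[OF lip[of x y] mult_left_mono[OF wn[of "x - y"], of L0]] \<open>L0 > 0\<close> l
    by (simp_all add: C_def mult.assoc)
  interpret \<gamma>: gauss_measure B "sqrt (det B1 * det B2 / (2 * pi) ^ (CARD('n) + CARD('m)))" "gaussian B1 B2"
    by (intro gauss_measure.intro gauss_measure_axioms.intro B.pos_def_axioms prob)
       (simp add: gaussian_def B)
  have der: "GDERIV f\<mu> x :> grad f\<mu> x" for x
  proof -
    have "f\<mu> = (\<lambda>z. \<integral>u. f (z + \<mu> *\<^sub>R u) \<partial>gaussian B1 B2)"
      unfolding assms(10) by (simp add: fun_eq_iff smoothing_def)
    then obtain D where D: "GDERIV f\<mu> x :> D"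
      using \<gamma>.GDERIV_smoothing[OF C(2,1) \<open>\<mu> > 0\<close>, of x] by blast
    then show ?thesis by (simp only: GDERIV_imp_grad_eq[OF D])
  qed
  have F_eq: "F x = flip_snd (grad f\<mu> x)" for x
    unfolding assms(11) by (rule GDERIV_imp_saddle_op_eq[OF der])
  \<comment> \<open>Passing from the dual norm to the Euclidean one on the left and from the primal
    norm on the right each costs a factor \<open>sqrt lmax\<close>.\<close>
  have F_lip: "norm (F x - F y) \<le> (L1 * lmax) * norm (x - y)" for x y
  proof -
    have "norm (F x - F y) = norm (flip_snd (grad f\<mu> x - grad f\<mu> y))"
      by (simp add: F_eq flip_snd_def)
    then have "(norm (F x - F y))\<^sup>2 \<le> lmax * (wnorm (inv B) (grad f\<mu> x - grad f\<mu> y))\<^sup>2"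
      using B.norm_le_dual by (simp add: norm_flip_snd lmax)
    also have "\<dots> \<le> lmax * (L1 * (sqrt lmax * norm (x - y)))\<^sup>2"
    proof (intro mult_left_mono power_mono)
      show "wnorm (inv B) (grad f\<mu> x - grad f\<mu> y) \<le> L1 * (sqrt lmax * norm (x - y))"
        using order_trans[OF grad_lip[of x y] mult_left_mono[OF wn[of "x - y"], of L1]] \<open>L1 > 0\<close> by simp
    qed (use l B.inv_form_nonneg in \<open>auto simp: wnorm_def\<close>)
    also have "\<dots> = ((L1 * lmax) * norm (x - y))\<^sup>2"
      using l by (simp add: power_mult_distrib power2_eq_square)
    finally show ?thesis by (rule power2_le_imp_le) (use l \<open>L1 > 0\<close> in auto)
  qed
  have "continuous_on UNIV F"
    using F_lip l \<open>L1 > 0\<close>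
    by (intro lipschitz_on_continuous_on[OF lipschitz_onI, of _ _ "L1 * lmax"]) (auto simp: dist_norm)
  then have F_meas: "F \<in> borel_measurable borel" by (rule borel_measurable_continuous_onI)
  interpret O: stochastic_oracle "gaussian B1 B2" G F "\<lambda>u. C * lmax * (norm u)\<^sup>2" "lmax * \<sigma>\<^sup>2"
    unfolding assms(10-12) lmax B
    by (rule zo_oracle_stochastic_oracle[OF assms(1,2) prob C \<open>\<mu> > 0\<close>])
       (rule F_meas[unfolded assms(10-12)] assms(16)[unfolded assms(10-12) B])+
  \<comment> \<open>Bounding the squared dual norm by the Euclidean one divided by
    \<open>lmin\<close> yields the Minty coefficient \<open>\<rho> / (2 * lmin)\<close>.\<close>
  have minty': "F w \<bullet> (w - zstar) + \<rho> / (2 * lmin) * (norm (F w))\<^sup>2 \<ge> 0" for w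
  proof -
    have "\<rho> / 2 * (wnorm (inv B) (F w))\<^sup>2 \<le> \<rho> / 2 * ((norm (F w))\<^sup>2 / lmin)"
      using B.dual_le_norm[of "F w"] \<open>0 \<le> \<rho>\<close> by (intro mult_left_mono) (auto simp: lmin)
    then show ?thesis using minty[of w] by simp
  qed
  \<comment> \<open>Because \<kappa> is at least 1, the step size bound implies the contraction
    condition for the Euclidean Lipschitz constant \<open>L1 * lmax\<close>.\<close>
  have "L1 * lmax * h1 \<le> L1 * lmax * h1 * \<kappa>"
    using \<kappa>1 \<open>h1 > 0\<close> \<open>L1 > 0\<close> l by simp
  also have "\<dots> \<le> 1" using assms(22) \<kappa>1 \<open>L1 > 0\<close> l by (simp add: field_simps)
  finally have Lh: "L1 * lmax * h1 \<le> 1" .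
  have "(h1 * h2 - h2\<^sup>2 - 2 * h2 * (\<rho> / (2 * lmin))) *
      (\<Sum>k\<le>N. expectation (\<lambda>\<omega>. (norm (F (zhat k \<omega>)))\<^sup>2))
    \<le> (norm (z0 - zstar))\<^sup>2 + (real N + 1) * ((3 * h1 * h2 + h2\<^sup>2) * (lmax * \<sigma>\<^sup>2))"
    by (rule O.stochastic_extragradient[OF assms(25-31) F_lip minty' _ _ _ Lh])
       (use \<open>h1 > 0\<close> \<open>h2 > 0\<close> \<open>L1 > 0\<close> l in auto)
  from bound_of_weighted_sum[OF l(1,2) _ \<open>L1 > 0\<close> \<open>h1 > 0\<close> \<open>h2 > 0\<close> _ _ _ \<open>0 \<le> \<rho>\<close> assms(22-24) this]
  show ?thesis
    using \<kappa>1 by (simp add: atLeast0AtMost sum_nonneg)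
qed

end
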